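(* Let $n\ge 2$, let $H=H_n\subseteq K_n$ be any (nonempty) graph, and let $J^{(t)}$, $t=0,1,\dots,M$, be its onion decomposition. Then: (a) For any $t=0,1,\dots,M-1$, given $J^{(t)}$, the choice of $J^{(t+1)}$ in step (ii) of the onion decomposition procedure is unique; that is, the onion decomposition of a given graph $H$ is unique. (b) For any $q\in[0,1)$, let $t=t(q)$ be such that $|J^{(t)}|/|H|\le q<|J^{(t+1)}|/|H|$. Then $$\varphi_q=n^{-\frac{|V(J^{(t+1)})\setminus V(J^{(t)})|}{|J^{(t+1)}\setminus J^{(t)}|}}=n^{-\frac1{\rho(J^{(t+1)}\mid J^{(t)})}},$$ i.e. the pair $(S=J^{(t)},J=J^{(t+1)})$ is a minimax optimal pair in the definition of $\varphi_q$ ($S$ attains the outer minimum and $J$ attains the inner maximum for this $S$). (c) The onion decomposition of $H$, and in particular the function $(\varphi_q)_{q\in[0,1]}$, can be computed in time polynomial in $|H|$.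
   Context: A graph $T$ on vertex set $[n]$ is identified with its edge set $T\subseteq\binom{[n]}{2}$; $|T|$ is its number of edges, $V(T)$ is the set of vertices incident to at least one edge of $T$, and $v(T)=|V(T)|$. Subgraph means subset of edges. For graphs $T_2\subseteq T_1$, $\rho(T_1\mid T_2)=\frac{|T_1\setminus T_2|}{|V(T_1)\setminus V(T_2)|}$, with $\rho(T_1\mid T_2)=+\infty$ (and $1/\rho=0$) when $V(T_1)=V(T_2)$. Onion decomposition of $H$: the increasing sequence of subgraphs of $H$ generated by the following procedure. (i) $J^{(0)}=\emptyset$. (ii) For each $t>0$, $J^{(t)}$ is an inclusion-maximal element of $\arg\max_{J:\,J^{(t-1)}\subsetneq J\subseteq H}\rho(J\mid J^{(t-1)})$. (iii) If $J^{(t)}=H$, stop. $M=M(H)\le|H|$ is the number of steps until termination, so $J^{(M)}=H$. For $q\in[0,1)$, $$\varphi_q=\min\Big\{\max\big\{n^{-\frac{|V(J)\setminus V(S)|}{|J\setminus S|}}: J\subseteq H,\ J\supsetneq S\big\}: S\subseteq H,\ |S|\le q|H|\Big\},$$ and $\varphi_1=0$. By "computing the function $(\varphi_q)_q$" one means computing its representation as a piecewise constant function of $q$: the breakpoints and the (rational) exponents of $n$ giving its values. *)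

theory Defs
  imports
    "HOL-Analysis.Analysis"
    "HOL-Library.Ramsey"
    "HOL-Computational_Algebra.Polynomial"
begin

section \<open>Graphs and the onion decomposition\<close>

type_synonym graph = "nat set set"

text \<open>The edge set of \<open>K\<^sub>n\<close>, i.e. all 2-subsets of \<open>{1..n}\<close>. Subgraphs are subsets of edges.\<close>

definition complete_graph :: "nat \<Rightarrow> graph" where
  "complete_graph n = [{1..n}]\<^bsup>2\<^esup>"

definition V :: "graph \<Rightarrow> nat set" where
  "V T = \<Union>T"

definition rho :: "graph \<Rightarrow> graph \<Rightarrow> ereal" where
  "rho T1 T2 =
    (if V T1 = V T2 then \<infinity>
     else ereal (real (card (T1 - T2)) / real (card (V T1 - V T2))))"

text \<open>\<open>J\<close> attains the maximal density relative to the previous subgraph \<open>S\<close>.\<close>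

definition rho_maximizer :: "graph \<Rightarrow> graph \<Rightarrow> graph \<Rightarrow> bool" where
  "rho_maximizer H S J \<longleftrightarrow> is_arg_max (\<lambda>J. rho J S) (\<lambda>J. S \<subset> J \<and> J \<subseteq> H) J"

definition onion_step :: "graph \<Rightarrow> graph \<Rightarrow> graph \<Rightarrow> bool" where
  "onion_step H S J \<longleftrightarrow>
    rho_maximizer H S J \<and> \<not> (\<exists>J'. rho_maximizer H S J' \<and> J \<subset> J')"

text \<open>A terminated run \<open>[J\<^sup>(\<^sup>0\<^sup>), \<dots>, J\<^sup>(\<^sup>M\<^sup>)]\<close> of the procedure; thus \<open>M\<close> is the length of the list minus 1.
  No step is possible from \<open>H\<close>, so \<open>H\<close> occurs only as the last entry.\<close>

definition onion_decomposition :: "graph \<Rightarrow> graph list \<Rightarrow> bool" where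
  "onion_decomposition H Js \<longleftrightarrow>
    Js \<noteq> [] \<and> Js ! 0 = {} \<and> last Js = H \<and>
    (\<forall>t. t + 1 < length Js \<longrightarrow> onion_step H (Js ! t) (Js ! (t + 1)))"

section \<open>The function \<open>\<phi>\<close>\<close>

definition phi_val :: "nat \<Rightarrow> graph \<Rightarrow> graph \<Rightarrow> real" where
  "phi_val n S J = real n powr (- (real (card (V J - V S)) / real (card (J - S))))"

definition phi_inner :: "nat \<Rightarrow> graph \<Rightarrow> graph \<Rightarrow> real" where
  "phi_inner n H S = Max {phi_val n S J | J. J \<subseteq> H \<and> S \<subset> J}"

definition phi :: "nat \<Rightarrow> graph \<Rightarrow> real \<Rightarrow> real" where
  "phi n H q =
    (if q = 1 then 0
     else Min {phi_inner n H S | S. S \<subseteq> H \<and> real (card S) \<le> q * real (card H)})"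

definition minimax_optimal :: "nat \<Rightarrow> graph \<Rightarrow> real \<Rightarrow> graph \<Rightarrow> graph \<Rightarrow> bool" where
  "minimax_optimal n H q S J \<longleftrightarrow>
    S \<subseteq> H \<and> real (card S) \<le> q * real (card H) \<and> phi_inner n H S = phi n H q \<and>
    J \<subseteq> H \<and> S \<subset> J \<and> phi_val n S J = phi_inner n H S"

section \<open>Polynomial time\<close>

text \<open>
  The model is a random access machine with unit cost, programmed in a structured language:
  a program uses finitely many scalar variables and finitely many arrays of natural numbers.
  Addition and truncated subtraction are the only arithmetic operations. In particular there is
  no unit-cost multiplication, so a run of \<open>t\<close> steps only produces numbers with \<open>O(t)\<close> more bits
  than the input numbers and the constants of the program, and polynomial time has its usual
  meaning. A number (such as a vertex label) occupies one cell, so that running times can be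
  measured in terms of the number of edges alone.
\<close>

datatype aexp =
    Const nat
  | Var nat
  | Cell nat aexp
  | Plus aexp aexp
  | Minus aexp aexp

datatype bexp =
    Less aexp aexp
  | BNot bexp
  | BAnd bexp bexp

datatype com =
    Skip
  | Assign nat aexp
  | Store nat aexp aexp
  | Seq com com
  | Cond bexp com com
  | While bexp com

record state =
  var :: "nat \<Rightarrow> nat"
  arr :: "nat \<Rightarrow> nat \<Rightarrow> nat"

fun aval :: "aexp \<Rightarrow> state \<Rightarrow> nat" where
  "aval (Const k) s = k"
| "aval (Var x) s = var s x"
| "aval (Cell a e) s = arr s a (aval e s)"
| "aval (Plus e f) s = aval e s + aval f s"
| "aval (Minus e f) s = aval e s - aval f s"

fun bval :: "bexp \<Rightarrow> state \<Rightarrow> bool" where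
  "bval (Less e f) s \<longleftrightarrow> aval e s < aval f s"
| "bval (BNot b) s \<longleftrightarrow> \<not> bval b s"
| "bval (BAnd b c) s \<longleftrightarrow> bval b s \<and> bval c s"

fun acost :: "aexp \<Rightarrow> nat" where
  "acost (Const k) = 1"
| "acost (Var x) = 1"
| "acost (Cell a e) = 1 + acost e"
| "acost (Plus e f) = 1 + acost e + acost f"
| "acost (Minus e f) = 1 + acost e + acost f"

fun bcost :: "bexp \<Rightarrow> nat" where
  "bcost (Less e f) = 1 + acost e + acost f"
| "bcost (BNot b) = 1 + bcost b"
| "bcost (BAnd b c) = 1 + bcost b + bcost c"

text \<open>\<open>exec c s t s'\<close>: started in \<open>s\<close>, program \<open>c\<close> terminates in \<open>s'\<close> after \<open>t\<close> elementary steps.\<close>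

inductive exec :: "com \<Rightarrow> state \<Rightarrow> nat \<Rightarrow> state \<Rightarrow> bool" where
  Skip: "exec Skip s 1 s"
| Assign: "exec (Assign x e) s (1 + acost e) (s\<lparr>var := (var s)(x := aval e s)\<rparr>)"
| Store: "exec (Store a i e) s (1 + acost i + acost e)
            (s\<lparr>arr := (arr s)(a := (arr s a)(aval i s := aval e s))\<rparr>)"
| Seq: "exec c s t s' \<Longrightarrow> exec d s' t' s'' \<Longrightarrow> exec (Seq c d) s (t + t') s''"
| CondTrue: "bval b s \<Longrightarrow> exec c s t s' \<Longrightarrow> exec (Cond b c d) s (1 + bcost b + t) s'"
| CondFalse: "\<not> bval b s \<Longrightarrow> exec d s t s' \<Longrightarrow> exec (Cond b c d) s (1 + bcost b + t) s'"
| WhileFalse: "\<not> bval b s \<Longrightarrow> exec (While b c) s (1 + bcost b) s"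
| WhileTrue: "bval b s \<Longrightarrow> exec c s t s' \<Longrightarrow> exec (While b c) s' t' s'' \<Longrightarrow>
    exec (While b c) s (1 + bcost b + t + t') s''"

inductive_cases exec_SkipE: "exec Skip s t s'"
inductive_cases exec_AssignE: "exec (Assign x e) s t s'"
inductive_cases exec_StoreE: "exec (Store a i e) s t s'"
inductive_cases exec_SeqE: "exec (Seq c d) s t s'"
inductive_cases exec_CondE: "exec (Cond b c d) s t s'"
inductive_cases exec_WhileE: "exec (While b c) s t s'"

lemma exec_deterministic:
  "exec c s t s' \<Longrightarrow> exec c s u r \<Longrightarrow> u = t \<and> r = s'"
proof (induction arbitrary: u r rule: exec.induct)
  case Skip
  then show ?case by (rule exec_SkipE) simp
next
  case Assign
  then show ?case by (rule exec_AssignE) simp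
next
  case Store
  then show ?case by (rule exec_StoreE) simp
next
  case Seq
  from Seq.prems show ?case by (rule exec_SeqE) (use Seq.IH in blast)
next
  case CondTrue
  from CondTrue.prems show ?case
    by (rule exec_CondE) (use CondTrue.hyps in \<open>auto dest!: CondTrue.IH\<close>)
next
  case CondFalse
  from CondFalse.prems show ?case
    by (rule exec_CondE) (use CondFalse.hyps in \<open>auto dest!: CondFalse.IH\<close>)
next
  case WhileFalse
  from WhileFalse.prems show ?case
    by (rule exec_WhileE) (use WhileFalse.hyps in auto)
next
  case WhileTrue
  from WhileTrue.prems show ?case
    by (rule exec_WhileE) (use WhileTrue.hyps in \<open>auto dest!: WhileTrue.IH\<close>)
qed

text \<open>The input is array 0, with its length in variable 0, everything else being 0;
  the output is array 1, with its length in variable 1.\<close>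

definition init_state :: "nat list \<Rightarrow> state" where
  "init_state ws =
    \<lparr>var = (\<lambda>x. if x = 0 then length ws else 0),
     arr = (\<lambda>a i. if a = 0 \<and> i < length ws then ws ! i else 0)\<rparr>"

definition output_of :: "state \<Rightarrow> nat list" where
  "output_of s = map (arr s 1) [0..<var s 1]"

text \<open>There is one program and one polynomial such that on every instance \<open>x\<close> and for every
  admissible input word \<open>ws\<close> of \<open>x\<close> the program terminates with a correct output, within time
  polynomial in the size of \<open>x\<close>.\<close>

definition poly_time_computable ::
    "('i \<Rightarrow> nat) \<Rightarrow> ('i \<Rightarrow> nat list \<Rightarrow> bool) \<Rightarrow> ('i \<Rightarrow> nat list \<Rightarrow> bool) \<Rightarrow> bool" where
  "poly_time_computable size_of input_word correct_output \<longleftrightarrow>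
    (\<exists>c (p :: nat poly). \<forall>x ws. input_word x ws \<longrightarrow>
      (\<exists>t s. exec c (init_state ws) t s \<and> t \<le> poly p (size_of x) \<and> correct_output x (output_of s)))"

text \<open>A graph is coded by an arbitrary repetition-free listing of its edges, preceded by the number
  of edges; each edge is given by its two endpoints in either order.\<close>

definition graph_code :: "graph \<Rightarrow> nat list \<Rightarrow> bool" where
  "graph_code G ws \<longleftrightarrow>
    (\<exists>es :: (nat \<times> nat) list.
      distinct (map (\<lambda>(u, v). {u, v}) es) \<and> set (map (\<lambda>(u, v). {u, v}) es) = G \<and>
      ws = length es # concat (map (\<lambda>(u, v). [u, v]) es))"

definition graph_list_code :: "graph list \<Rightarrow> nat list \<Rightarrow> bool" where
  "graph_list_code Gs ws \<longleftrightarrow>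
    (\<exists>wss. list_all2 graph_code Gs wss \<and> ws = length Gs # concat wss)"

text \<open>A list of quadruples \<open>(b, d, a, e)\<close>, one for each maximal interval \<open>[b / d, \<dots>)\<close> in \<open>[0, 1)\<close>
  on which \<open>\<phi>\<close> is constant, with value \<open>n\<^sup>-\<^sup>a\<^sup>/\<^sup>e\<close>. Each interval ends where the next one begins,
  the last one ends at 1. The value at 1 itself is the constant 0 for every graph.\<close>

definition phi_representation :: "nat \<Rightarrow> graph \<Rightarrow> (nat \<times> nat \<times> nat \<times> nat) list \<Rightarrow> bool" where
  "phi_representation n H ps \<longleftrightarrow>
    (let k = length ps;
         bp = (\<lambda>i. if i < k then (case ps ! i of (b, d, a, e) \<Rightarrow> real b / real d) else 1);
         ex = (\<lambda>i. case ps ! i of (b, d, a, e) \<Rightarrow> real a / real e)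
     in 0 < k \<and> (\<forall>(b, d, a, e) \<in> set ps. 0 < d \<and> 0 < e) \<and> bp 0 = 0 \<and>
        (\<forall>i<k. bp i < bp (i + 1) \<and>
               (\<forall>q. bp i \<le> q \<and> q < bp (i + 1) \<longrightarrow> phi n H q = real n powr (- ex i))) \<and>
        (\<forall>i. i + 1 < k \<longrightarrow> ex i \<noteq> ex (i + 1)))"

definition phi_code :: "nat \<Rightarrow> graph \<Rightarrow> nat list \<Rightarrow> bool" where
  "phi_code n H ws \<longleftrightarrow>
    (\<exists>ps. phi_representation n H ps \<and>
      ws = length ps # concat (map (\<lambda>(b, d, a, e). [b, d, a, e]) ps))"

end

theory Submission
  imports Defs
begin

text \<open>
  Uniqueness of a step holds because relative density maximizers are closed under union: \<open>|J|\<close> is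
  modular and \<open>|V J|\<close> submodular. By maximality the densities decrease strictly along the
  decomposition, which gives the minimax property by adding to a small \<open>S\<close> the first layer it misses.

  For the algorithm, every edge distributes \<open>N\<close> tokens between its two endpoints, and the load of a
  vertex is the number of tokens it receives. As long as some edge gives a token to an endpoint whose
  load exceeds that of the other one by at least 2, this token is moved; the sum of the squared loads
  decreases, so this stops after polynomially many moves if \<open>N\<close> is polynomial. Afterwards, whenever
  the load \<open>r\<close> occurs and \<open>r - 1\<close> does not, an edge from a vertex of load at least \<open>r\<close> to one of smaller
  load gives all its tokens to the latter. Counting tokens then shows that, for \<open>N > |V H|\<^sup>3\<close>, the edges
  with both loads at least \<open>r\<close>, for these \<open>r\<close> in decreasing order, are the onion decomposition. No
  flow computation is needed, and the existence of the decomposition is a by-product.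
\<close>

section \<open>Uniqueness and the minimax property\<close>

text \<open>The value infinity of \<open>rho\<close> is the first obstacle: it occurs when new edges
  bring no new vertex. Every term of the decomposition contains all edges of \<open>H\<close> on its
  own vertices, so no competitor has infinite density, and densities are compared through products
  of natural numbers.

  The tokens discretize a fractional orientation. In an exactly balanced one, an edge pays no
  endpoint of larger load, and the vertices of a layer all have load \<open>N\<close> times the
  density of the layer. Indivisible tokens leave a tolerance of one per edge, and loads can drift
  along a path inside a layer. The missing value \<open>r - 1\<close> restores exactness at the
  boundary: across it loads drop by at least two, which exceeds the tolerance. The cubic size of
  \<open>N\<close> makes the drift inside a layer harmless. Since \<open>H\<close> has at most twice
  as many vertices as edges, a suitable \<open>N\<close> is computable from the number of edges by
  additions.

  Loads, thresholds and the sum of squared loads are polynomial in the number of edges. The possible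
  load values can therefore be tried one by one, and the programs neither sort nor handle
  fractions.\<close>

definition induced_in :: "graph \<Rightarrow> graph \<Rightarrow> bool" where
  "induced_in H S \<longleftrightarrow> (\<forall>e\<in>H. e \<subseteq> V S \<longrightarrow> e \<in> S)"

lemma V_mono: "S \<subseteq> T \<Longrightarrow> V S \<subseteq> V T"
  by (auto simp: V_def)

lemma V_Un: "V (S \<union> T) = V S \<union> V T"
  by (auto simp: V_def)

lemma V_empty [simp]: "V {} = {}"
  by (simp add: V_def)

lemma card_Diff_chain:
  assumes "finite C" "A \<subseteq> B" "B \<subseteq> C"
  shows "card (C - A) = card (C - B) + card (B - A)"
proof -
  have "C - A = (C - B) \<union> (B - A)" using assms by auto
  moreover have "finite B" using assms finite_subset by blast
  ultimately show ?thesis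
    using assms by (simp add: card_Un_disjoint disjoint_iff)
qed

section \<open>Relative densities over induced subgraphs\<close>

locale simple_graph =
  fixes H :: graph
  assumes finite_H: "finite H" and card_edge: "e \<in> H \<Longrightarrow> card e = 2"
begin

lemma finite_sub: "J \<subseteq> H \<Longrightarrow> finite J"
  using finite_H finite_subset by blast

lemma finite_V: "J \<subseteq> H \<Longrightarrow> finite (V J)"
  unfolding V_def using finite_sub card_edge
  by (metis card.infinite finite_Union subsetD zero_neq_numeral)

lemma induced_empty: "induced_in H {}"
  using card_edge by (fastforce simp: induced_in_def)

lemma card_new_edges_pos: "J \<subseteq> H \<Longrightarrow> S \<subset> J \<Longrightarrow> 0 < card (J - S)"
  by (simp add: card_gt_0_iff finite_sub psubset_imp_ex_mem)

lemma card_new_vertices_pos: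
  assumes "induced_in H S" "S \<subset> J" "J \<subseteq> H"
  shows "0 < card (V J - V S)"
proof -
  obtain e where "e \<in> J" "e \<notin> S" using assms by auto
  then have "\<not> e \<subseteq> V S" using assms by (auto simp: induced_in_def)
  moreover have "e \<subseteq> V J" using \<open>e \<in> J\<close> by (auto simp: V_def)
  ultimately have "V J - V S \<noteq> {}" by auto
  then show ?thesis using finite_V[OF assms(3)] by (simp add: card_gt_0_iff)
qed

lemma rho_induced:
  assumes "induced_in H S" "S \<subset> J" "J \<subseteq> H"
  shows "rho J S = ereal (real (card (J - S)) / real (card (V J - V S)))"
  using card_new_vertices_pos[OF assms] by (auto simp: rho_def)

lemma rho_le_iff:
  assumes "induced_in H S" "S \<subset> J" "J \<subseteq> H" "S \<subset> K" "K \<subseteq> H"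
  shows "rho K S \<le> rho J S \<longleftrightarrow>
    card (K - S) * card (V J - V S) \<le> card (J - S) * card (V K - V S)"
proof -
  have "0 < card (V J - V S)" "0 < card (V K - V S)"
    using assms card_new_vertices_pos by auto
  then show ?thesis
    using rho_induced[OF assms(1-3)] rho_induced[OF assms(1,4,5)]
    by (simp add: field_simps flip: of_nat_mult)
qed

lemma rho_maximizer_rho:
  "rho_maximizer H S J \<longleftrightarrow>
    S \<subset> J \<and> J \<subseteq> H \<and> (\<forall>K. S \<subset> K \<longrightarrow> K \<subseteq> H \<longrightarrow> rho K S \<le> rho J S)"
  unfolding rho_maximizer_def is_arg_max_linorder by blast

lemma rho_maximizerD:
  assumes "rho_maximizer H S J"
  shows "S \<subset> J" "J \<subseteq> H"
  using assms unfolding rho_maximizer_rho by simp_all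

lemma rho_maximizer_iff:
  assumes "induced_in H S"
  shows "rho_maximizer H S J \<longleftrightarrow> S \<subset> J \<and> J \<subseteq> H \<and>
    (\<forall>K. S \<subset> K \<longrightarrow> K \<subseteq> H \<longrightarrow>
      card (K - S) * card (V J - V S) \<le> card (J - S) * card (V K - V S))"
  unfolding rho_maximizer_rho using rho_le_iff[OF assms] by meson

lemma onion_stepD:
  assumes "onion_step H S J"
  shows "S \<subset> J" "J \<subseteq> H" "rho_maximizer H S J"
  using assms rho_maximizerD[of S J] unfolding onion_step_def by simp_all

text \<open>An omitted edge on the vertices of \<open>J\<close> could be added without a new vertex:
  the number of new edges grows, the positive number of new vertices stays, and the density would
  exceed the maximum.\<close>

lemma induced_step:
  assumes "induced_in H S" "onion_step H S J"
  shows "induced_in H J"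
  unfolding induced_in_def
proof (intro ballI impI, rule ccontr)
  fix e assume e: "e \<in> H" "e \<subseteq> V J" "e \<notin> J"
  note J = onion_stepD[OF assms(2)]
  let ?K = "insert e J"
  have "V ?K = V J" using e by (auto simp: V_def)
  moreover have "?K - S = insert e (J - S)" using e J by auto
  then have "card (?K - S) = Suc (card (J - S))"
    using e finite_sub[OF J(2)] by simp
  moreover have "card (?K - S) * card (V J - V S) \<le> card (J - S) * card (V ?K - V S)"
  proof -
    have "S \<subset> ?K" "?K \<subseteq> H" using J e by auto
    then show ?thesis using J(3) rho_maximizer_iff[OF assms(1), of J] by blast
  qed
  ultimately have "Suc (card (J - S)) * card (V J - V S) \<le> card (J - S) * card (V J - V S)"
    by metis
  then show False using card_new_vertices_pos[OF assms(1) J(1,2)] by auto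
qed

text \<open>Uncrossing: \<open>J\<close> and \<open>K\<close> have the same density over
  \<open>S\<close>, and their intersection has at most that density. Subtracting the intersection
  from the sum of the two leaves at least that density for the union.\<close>

lemma rho_maximizer_Un:
  assumes S: "induced_in H S" and J: "rho_maximizer H S J" and K: "rho_maximizer H S K"
  shows "rho_maximizer H S (J \<union> K)"
proof -
  have J': "S \<subset> J" "J \<subseteq> H" and K': "S \<subset> K" "K \<subseteq> H"
    using rho_maximizerD[OF J] rho_maximizerD[OF K] by simp_all
  let ?c = "\<lambda>X. card (X - S)" and ?d = "\<lambda>X. card (V X - V S)"
  have dpos: "0 < ?d J" using card_new_vertices_pos[OF S J'] .
  have eq: "?c K * ?d J = ?c J * ?d K"
    using J K J' K' unfolding rho_maximizer_iff[OF S] by (meson le_antisym)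
  \<comment> \<open>The intersection may be \<open>S\<close> itself, which is not a competitor; both
    sides are then zero.\<close>
  have inter: "?c (J \<inter> K) * ?d J \<le> ?c J * ?d (J \<inter> K)"
  proof (cases "J \<inter> K = S")
    case False
    then have "S \<subset> J \<inter> K" "J \<inter> K \<subseteq> H" using J' K' by auto
    then show ?thesis using J unfolding rho_maximizer_iff[OF S] by simp
  qed simp
  have "card ((J - S) \<union> (K - S)) + card ((J - S) \<inter> (K - S)) = ?c J + ?c K"
    using J' K' finite_sub by (intro card_Un_Int[symmetric]) auto
  moreover have "(J - S) \<union> (K - S) = J \<union> K - S" "(J - S) \<inter> (K - S) = J \<inter> K - S" by auto
  ultimately have c: "?c (J \<union> K) + ?c (J \<inter> K) = ?c J + ?c K" by simp
  have fin: "finite (V J - V S)" "finite (V K - V S)" using J' K' finite_V by auto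
  have "card ((V J - V S) \<union> (V K - V S)) + card ((V J - V S) \<inter> (V K - V S)) = ?d J + ?d K"
    by (rule card_Un_Int[OF fin, symmetric])
  moreover have "V (J \<union> K) - V S = (V J - V S) \<union> (V K - V S)" by (auto simp: V_Un)
  \<comment> \<open>Only an inequality: a vertex can be shared by \<open>J\<close> and
    \<open>K\<close> through different edges.\<close>
  moreover have "card (V (J \<inter> K) - V S) \<le> card ((V J - V S) \<inter> (V K - V S))"
    using fin by (intro card_mono) (auto simp: V_def)
  ultimately have d: "?d (J \<union> K) + ?d (J \<inter> K) \<le> ?d J + ?d K" by simp
  have "?c J * ?d (J \<union> K) + ?c J * ?d (J \<inter> K) \<le> ?c J * ?d J + ?c J * ?d K"
    using mult_le_mono2[OF d, of "?c J"] by (simp add: distrib_left)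
  moreover have "?c (J \<union> K) * ?d J + ?c (J \<inter> K) * ?d J = ?c J * ?d J + ?c K * ?d J"
    using arg_cong[OF c, of "\<lambda>x. x * ?d J"] by (simp add: distrib_right)
  ultimately have *: "?c J * ?d (J \<union> K) \<le> ?c (J \<union> K) * ?d J"
    using inter eq by linarith
  have "rho J S \<le> rho (J \<union> K) S"
    using * J' K' S by (subst rho_le_iff) auto
  then show ?thesis
    using J J' K' unfolding rho_maximizer_rho by (meson Un_least order_trans psubsetE sup.strict_coboundedI1)
qed

lemma onion_step_unique:
  assumes "induced_in H S" "onion_step H S J" "onion_step H S K"
  shows "J = K"
  using assms rho_maximizer_Un[of S J K] unfolding onion_step_def
  by (metis psubsetI sup_ge1 sup_ge2)

text \<open>By inclusion-maximality of \<open>J\<close>, the larger \<open>K\<close> is no maximizer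
  over \<open>S\<close>, so its density over \<open>S\<close> is strictly smaller than that of
  \<open>J\<close>. It is the mediant of the densities of \<open>J\<close> over \<open>S\<close> and
  of \<open>K\<close> over \<open>J\<close>, so the latter is the smaller one.\<close>

lemma onion_step_density_decreasing:
  assumes S: "induced_in H S" and J: "onion_step H S J" and K: "onion_step H J K"
  shows "card (K - J) * card (V J - V S) < card (J - S) * card (V K - V J)"
proof -
  note J' = onion_stepD[OF J] and K' = onion_stepD[OF K]
  have SK: "S \<subset> K" using J' K' by auto
  have "\<not> rho_maximizer H S K" using J K' by (auto simp: onion_step_def)
  then have "\<not> rho J S \<le> rho K S"
    using J'(3) SK K'(2) unfolding rho_maximizer_rho by (meson order_trans)
  then have "card (K - S) * card (V J - V S) < card (J - S) * card (V K - V S)"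
    using rho_le_iff[OF S SK K'(2) J'(1,2)] by (simp add: mult.commute not_le)
  moreover have "card (K - S) = card (K - J) + card (J - S)"
    using J' K' finite_sub by (intro card_Diff_chain) auto
  moreover have "card (V K - V S) = card (V K - V J) + card (V J - V S)"
    using J' K' finite_V by (intro card_Diff_chain V_mono) auto
  ultimately show ?thesis by (simp add: algebra_simps)
qed

end

section \<open>The sequence of layers and the function \<open>phi\<close>\<close>

locale onion = simple_graph +
  fixes Js :: "graph list"
  assumes onion: "onion_decomposition H Js"
begin

text \<open>The quotient of \<open>verts_at t\<close> by \<open>edges_at t\<close> is the reciprocal
  density of step \<open>t\<close>, hence, up to sign, the exponent of \<open>n\<close> in the value
  of \<open>phi\<close>.\<close>

definition edges_at :: "nat \<Rightarrow> nat" where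
  "edges_at t = card (Js ! (t + 1) - Js ! t)"

definition verts_at :: "nat \<Rightarrow> nat" where
  "verts_at t = card (V (Js ! (t + 1)) - V (Js ! t))"

lemma first: "Js ! 0 = {}" and last: "last Js = H" and nonempty: "Js \<noteq> []"
  and step: "t + 1 < length Js \<Longrightarrow> onion_step H (Js ! t) (Js ! (t + 1))"
  using onion by (auto simp: onion_decomposition_def)

lemma induced_nth: "t < length Js \<Longrightarrow> induced_in H (Js ! t)"
proof (induction t)
  case 0 then show ?case using first induced_empty by simp
next
  case (Suc t) then show ?case using step[of t] induced_step by simp
qed

lemma sub_nth: "t < length Js \<Longrightarrow> Js ! t \<subseteq> H"
  using first step[of "t - 1"] onion_stepD(2) by (cases t) auto

lemma psubset_nth: "t + 1 < length Js \<Longrightarrow> Js ! t \<subset> Js ! (t + 1)"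
  using step onion_stepD(1) by blast

lemma mono_nth: "s \<le> t \<Longrightarrow> t < length Js \<Longrightarrow> Js ! s \<subseteq> Js ! t"
proof (induction t)
  case (Suc t)
  then show ?case using psubset_nth[of t] by (cases "s = Suc t") auto
qed simp

lemma edges_at_pos: "t + 1 < length Js \<Longrightarrow> 0 < edges_at t"
  unfolding edges_at_def using psubset_nth sub_nth by (intro card_new_edges_pos) auto

lemma verts_at_pos: "t + 1 < length Js \<Longrightarrow> 0 < verts_at t"
  unfolding verts_at_def using psubset_nth sub_nth induced_nth
  by (intro card_new_vertices_pos) auto

lemma card_nth_Suc: "t + 1 < length Js \<Longrightarrow> card (Js ! t) < card (Js ! (t + 1))"
  using psubset_nth sub_nth[of "t + 1"] finite_sub by (intro psubset_card_mono) auto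

lemma exponent_less:
  assumes "t + 2 < length Js"
  shows "real (verts_at t) / real (edges_at t)
    < real (verts_at (t + 1)) / real (edges_at (t + 1))"
proof -
  have "edges_at (t + 1) * verts_at t < edges_at t * verts_at (t + 1)"
    unfolding edges_at_def verts_at_def
    using onion_step_density_decreasing[OF induced_nth[of t] step[of t] step[of "t + 1"]] assms
    by simp
  then show ?thesis
    using edges_at_pos[of t] edges_at_pos[of "t + 1"] assms
    by (simp add: field_simps flip: of_nat_mult)
qed

lemma exponent_mono:
  assumes "s \<le> t" "t + 1 < length Js"
  shows "real (verts_at s) / real (edges_at s) \<le> real (verts_at t) / real (edges_at t)"
  using assms
proof (induction t)
  case (Suc t)
  then show ?case using exponent_less[of t] by (cases "s = Suc t") force+
qed simp

lemma exponent_minimal: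
  assumes t: "t + 1 < length Js" and J: "J \<subseteq> H" "Js ! t \<subset> J"
  shows "real (verts_at t) / real (edges_at t)
    \<le> real (card (V J - V (Js ! t))) / real (card (J - Js ! t))"
proof -
  have "card (J - Js ! t) * verts_at t \<le> edges_at t * card (V J - V (Js ! t))"
    unfolding edges_at_def verts_at_def
    using onion_stepD(3)[OF step[OF t]] rho_maximizer_iff[OF induced_nth[of t]] t J
    by simp
  then show ?thesis
    using edges_at_pos[OF t] card_new_edges_pos[OF J] by (simp add: field_simps flip: of_nat_mult)
qed

text \<open>If \<open>S\<close> is too small to contain \<open>J\<^sup>(\<^sup>t\<^sup>+\<^sup>1\<^sup>)\<close>, add to \<open>S\<close> the first layer it does not contain.\<close>

lemma dense_extension:
  assumes t: "t + 1 < length Js" and S: "S \<subseteq> H" "card S < card (Js ! (t + 1))"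
  shows "\<exists>J\<subseteq>H. S \<subset> J \<and>
    real (card (V J - V S)) / real (card (J - S)) \<le> real (verts_at t) / real (edges_at t)"
proof -
  define i where "i = (LEAST i. \<not> Js ! i \<subseteq> S)"
  have "\<not> Js ! (t + 1) \<subseteq> S" using S card_mono[OF finite_sub, of S "Js ! (t + 1)"] by auto
  then have i: "\<not> Js ! i \<subseteq> S" "i \<le> t + 1"
    unfolding i_def by (rule LeastI, rule Least_le)
  then obtain s where s: "i = s + 1" using first by (cases i) auto
  have "Js ! s \<subseteq> S" using not_less_Least[of s "\<lambda>i. \<not> Js ! i \<subseteq> S"] s by (auto simp: i_def)
  have st: "s \<le> t" "s + 1 < length Js" using i s t by auto
  define A where "A = Js ! s"
  define B where "B = Js ! (s + 1)"
  \<comment> \<open>\<open>R\<close> is the part of the layer from \<open>A\<close> to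
    \<open>B\<close> already contained in \<open>S\<close>. From \<open>A\<close> to
    \<open>R\<close> the density is at most that from \<open>A\<close> to \<open>B\<close>, so from
    \<open>R\<close> to \<open>B\<close> it is at least as large.\<close>
  define R where "R = S \<inter> B"
  let ?J = "S \<union> B"
  have AB: "A \<subset> B" "B \<subseteq> H" "A \<subseteq> R" "R \<subseteq> B"
    using psubset_nth[OF st(2)] sub_nth[OF st(2)] \<open>Js ! s \<subseteq> S\<close> by (auto simp: A_def B_def R_def)
  have SJ: "?J \<subseteq> H" "S \<subset> ?J" using S AB i s by (auto simp: B_def)
  have "card (R - A) * verts_at s \<le> edges_at s * card (V R - V A)"
  proof (cases "R = A")
    case False
    then have "A \<subset> R" "R \<subseteq> H" using AB S by auto
    then show ?thesis
      using rho_maximizer_iff[OF induced_nth, of s "Js ! (s+1)"] onion_stepD(3)[OF step[OF st(2)]] st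
      unfolding edges_at_def verts_at_def A_def by simp
  qed simp
  moreover have "edges_at s = card (B - R) + card (R - A)"
    unfolding edges_at_def A_def[symmetric] B_def[symmetric]
    using AB finite_sub by (intro card_Diff_chain) auto
  moreover have "verts_at s = card (V B - V R) + card (V R - V A)"
    unfolding verts_at_def A_def[symmetric] B_def[symmetric]
    using AB finite_V by (intro card_Diff_chain V_mono) auto
  ultimately have "edges_at s * card (V B - V R) \<le> card (B - R) * verts_at s"
    by (smt (verit) add_le_cancel_left add_le_cancel_right add_mult_distrib add_mult_distrib2 le_add2 mult.commute order_trans add.commute)
  \<comment> \<open>Passing from \<open>R\<close> to \<open>S\<close> keeps the set of edges to be
    added and can only reduce the set of vertices to be added.\<close>
  moreover have "card (V ?J - V S) \<le> card (V B - V R)"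
    using finite_V AB by (intro card_mono) (auto simp: V_def R_def)
  ultimately have "edges_at s * card (V ?J - V S) \<le> card (B - R) * verts_at s"
    by (meson le_trans mult_le_mono2)
  moreover have "B - R = ?J - S" by (auto simp: R_def)
  ultimately have "edges_at s * card (V ?J - V S) \<le> card (?J - S) * verts_at s" by simp
  then have "real (card (V ?J - V S)) / real (card (?J - S)) \<le> real (verts_at s) / real (edges_at s)"
    using edges_at_pos[OF st(2)] card_new_edges_pos[OF SJ]
    by (simp add: field_simps flip: of_nat_mult)
  also have "\<dots> \<le> real (verts_at t) / real (edges_at t)"
    using exponent_mono st t by blast
  finally show ?thesis using SJ by blast
qed

lemma finite_phi_vals: "finite {phi_val n S J | J. J \<subseteq> H \<and> S \<subset> J}"
  using finite_H by simp

text \<open>The base is at least 1, so maximizing \<open>phi_val\<close> amounts to minimizing the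
  exponent, that is, to maximizing the density over \<open>Js ! t\<close>.\<close>

lemma phi_inner_nth:
  assumes n: "2 \<le> n" and t: "t + 1 < length Js"
  shows "phi_inner n H (Js ! t) = phi_val n (Js ! t) (Js ! (t + 1))"
  unfolding phi_inner_def
proof (rule Max_eqI[OF finite_phi_vals])
  fix y assume "y \<in> {phi_val n (Js ! t) J | J. J \<subseteq> H \<and> Js ! t \<subset> J}"
  then obtain J where J: "y = phi_val n (Js ! t) J" "J \<subseteq> H" "Js ! t \<subset> J" by blast
  show "y \<le> phi_val n (Js ! t) (Js ! (t + 1))"
    using exponent_minimal[OF t J(2,3)] n unfolding J(1) phi_val_def edges_at_def verts_at_def
    by (intro powr_mono) auto
qed (use sub_nth[OF t] psubset_nth[OF t] in blast)

lemma phi_inner_ge: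
  assumes n: "2 \<le> n" and t: "t + 1 < length Js" and S: "S \<subseteq> H" "card S < card (Js ! (t + 1))"
  shows "phi_val n (Js ! t) (Js ! (t + 1)) \<le> phi_inner n H S"
proof -
  obtain J where J: "J \<subseteq> H" "S \<subset> J"
    "real (card (V J - V S)) / real (card (J - S)) \<le> real (verts_at t) / real (edges_at t)"
    using dense_extension[OF t S] by blast
  have "phi_val n (Js ! t) (Js ! (t + 1)) \<le> phi_val n S J"
    using J(3) n unfolding phi_val_def edges_at_def verts_at_def by (intro powr_mono) auto
  also have "\<dots> \<le> phi_inner n H S"
    unfolding phi_inner_def using J by (intro Max_ge finite_phi_vals) auto
  finally show ?thesis .
qed

text \<open>An admissible \<open>S\<close> has fewer edges than \<open>Js ! (t + 1)\<close>, so
  \<open>phi_inner_ge\<close> bounds its inner maximum from below; the bound is attained at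
  \<open>Js ! t\<close>, which is itself admissible.\<close>

lemma phi_eq:
  assumes n: "2 \<le> n" and t: "t + 1 < length Js" and q: "q < 1"
    "real (card (Js ! t)) \<le> q * real (card H)" "q * real (card H) < real (card (Js ! (t + 1)))"
  shows "phi n H q = phi_inner n H (Js ! t)"
proof -
  have "finite {phi_inner n H S | S. S \<subseteq> H \<and> real (card S) \<le> q * real (card H)}"
    using finite_H by simp
  moreover have "phi_inner n H (Js ! t) \<le> phi_inner n H S"
    if "S \<subseteq> H" "real (card S) \<le> q * real (card H)" for S
    using phi_inner_ge[OF n t that(1)] phi_inner_nth[OF n t] that(2) q(3) by linarith
  moreover have "Js ! t \<subseteq> H" using sub_nth t by auto
  ultimately show ?thesis
    unfolding phi_def using q by (auto intro!: Min_eqI)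
qed

lemma card_mono_nth: "s \<le> t \<Longrightarrow> t < length Js \<Longrightarrow> card (Js ! s) \<le> card (Js ! t)"
  using mono_nth sub_nth finite_sub card_mono by metis

lemma interval_exists:
  assumes "H \<noteq> {}" "0 \<le> q" "q < 1"
  shows "\<exists>!t. t + 1 < length Js \<and> real (card (Js ! t)) / real (card H) \<le> q \<and>
            q < real (card (Js ! (t + 1))) / real (card H)"
proof -
  have pos: "0 < real (card H)" using assms finite_H by (simp add: card_gt_0_iff)
  define P where "P = (\<lambda>t. t < length Js \<and> q < real (card (Js ! t)) / real (card H))"
  have "P (length Js - 1)"
    using nonempty last assms pos by (simp add: P_def last_conv_nth)
  then have L: "P (LEAST t. P t)" by (rule LeastI)
  moreover have "\<not> P 0" using first assms by (simp add: P_def)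
  ultimately obtain s where s: "(LEAST t. P t) = Suc s" by (metis not0_implies_Suc)
  have "\<not> P s" using not_less_Least[of s P] s by simp
  with L s have ex: "s + 1 < length Js \<and> real (card (Js ! s)) / real (card H) \<le> q \<and>
            q < real (card (Js ! (s + 1))) / real (card H)" by (auto simp: P_def)
  moreover have "t = s" if t: "t + 1 < length Js \<and> real (card (Js ! t)) / real (card H) \<le> q \<and>
            q < real (card (Js ! (t + 1))) / real (card H)" for t
  proof -
    have "real (card (Js ! t)) < real (card (Js ! (s + 1)))" "real (card (Js ! s)) < real (card (Js ! (t + 1)))"
      using t ex pos by (auto simp: divide_le_eq less_divide_eq intro: le_less_trans)
    then show ?thesis
      using card_mono_nth[of "s + 1" t] card_mono_nth[of "t + 1" s] t ex by (force simp: not_less)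
  qed
  ultimately show ?thesis by blast
qed

lemma inverse_rho_nth:
  assumes "t + 1 < length Js"
  shows "real_of_ereal (1 / rho (Js ! (t + 1)) (Js ! t)) = real (verts_at t) / real (edges_at t)"
  using rho_induced[OF induced_nth[of t] psubset_nth[of t] sub_nth[of "t + 1"]] assms edges_at_pos[OF assms]
    verts_at_pos[OF assms]
  by (simp add: edges_at_def verts_at_def one_ereal_def)

lemma minimax_nth:
  assumes n: "2 \<le> n" and ne: "H \<noteq> {}" and t: "t + 1 < length Js" and q: "q < 1"
    "real (card (Js ! t)) / real (card H) \<le> q" "q < real (card (Js ! (t + 1))) / real (card H)"
  shows "phi n H q = real n powr (- (real (verts_at t) / real (edges_at t)))"
    and "minimax_optimal n H q (Js ! t) (Js ! (t + 1))"
proof -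
  have pos: "0 < real (card H)" using ne finite_H by (simp add: card_gt_0_iff)
  then have q': "real (card (Js ! t)) \<le> q * real (card H)" "q * real (card H) < real (card (Js ! (t + 1)))"
    using q by (auto simp: field_simps)
  note eq = phi_eq[OF n t q(1) q'] phi_inner_nth[OF n t]
  show "phi n H q = real n powr (- (real (verts_at t) / real (edges_at t)))"
    using eq by (simp add: phi_val_def verts_at_def edges_at_def)
  show "minimax_optimal n H q (Js ! t) (Js ! (t + 1))"
    using eq q' sub_nth[of t] sub_nth[of "t + 1"] psubset_nth[OF t] t
    by (auto simp: minimax_optimal_def)
qed

text \<open>The exponents increase strictly along the decomposition. Neighbouring intervals thus
  carry different exponents, and the intervals between consecutive edge fractions are the maximal
  ones.\<close>

lemma phi_representation_onion:
  assumes n: "2 \<le> n" and ne: "H \<noteq> {}"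
  shows "phi_representation n H
    (map (\<lambda>t. (card (Js ! t), card H, verts_at t, edges_at t)) [0..<length Js - 1])"
    (is "phi_representation n H ?ps")
proof -
  have pos: "0 < card H" using ne finite_H by (simp add: card_gt_0_iff)
  have len: "1 < length Js"
    using ne first last nonempty by (cases Js rule: list.exhaust) (auto simp: Suc_lessI split: if_splits)
  define bp where "bp = (\<lambda>i. real (card (Js ! i)) / real (card H))"
  \<comment> \<open>Past the last quadruple the default value 1 agrees with \<open>bp\<close>,
    because the last graph is \<open>H\<close>.\<close>
  have bp: "(if i < length ?ps then (case ?ps ! i of (b, d, a, e) \<Rightarrow> real b / real d) else 1) = bp i"
    if "i < length Js" for i
  proof (cases "i < length ?ps")
    case False
    then have "i = length Js - 1" using that by simp
    then have "Js ! i = H" using last nonempty by (simp add: last_conv_nth)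
    with pos False show ?thesis by (simp add: bp_def)
  qed (simp add: bp_def)
  have lt: "bp i < bp (i + 1)" if "i + 1 < length Js" for i
    using card_nth_Suc[OF that] pos by (simp add: bp_def divide_strict_right_mono)
  have le1: "bp i \<le> 1" if "i < length Js" for i
    using card_mono[OF finite_H sub_nth[OF that]] pos by (simp add: bp_def)
  have val: "phi n H q = real n powr (- (real (verts_at i) / real (edges_at i)))"
    if "i + 1 < length Js" "bp i \<le> q" "q < bp (i + 1)" for i q
    using minimax_nth(1)[OF n ne that(1), of q] that le1[OF that(1)] by (simp add: bp_def)
  show ?thesis
    unfolding phi_representation_def Let_def
  proof (intro conjI allI impI)
    show "0 < length ?ps" using len by simp
    show "\<forall>(b, d, a, e)\<in>set ?ps. 0 < d \<and> 0 < e" using pos edges_at_pos by auto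
    show "(if 0 < length ?ps then case ?ps ! 0 of (b, d, a, e) \<Rightarrow> real b / real d else 1) = 0"
      using bp[of 0] first len by (simp add: bp_def)
  next
    fix i assume i: "i < length ?ps"
    then have i': "i + 1 < length Js" by simp
    have b: "(if i < length ?ps then case ?ps ! i of (b, d, a, e) \<Rightarrow> real b / real d else 1) = bp i"
      "(if i + 1 < length ?ps then case ?ps ! (i+1) of (b, d, a, e) \<Rightarrow> real b / real d else 1) = bp (i+1)"
      using i' by (intro bp; simp)+
    show "(if i < length ?ps then case ?ps ! i of (b, d, a, e) \<Rightarrow> real b / real d else 1)
         < (if i + 1 < length ?ps then case ?ps ! (i+1) of (b, d, a, e) \<Rightarrow> real b / real d else 1)"
      unfolding b using lt i' by simp
    fix q assume "(if i < length ?ps then case ?ps ! i of (b, d, a, e) \<Rightarrow> real b / real d else 1) \<le> q \<and>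
      q < (if i + 1 < length ?ps then case ?ps ! (i+1) of (b, d, a, e) \<Rightarrow> real b / real d else 1)"
    then show "phi n H q = real n powr - (case ?ps ! i of (b, d, a, e) \<Rightarrow> real a / real e)"
      unfolding b using val i' i by simp
  next
    fix i assume i: "i + 1 < length ?ps"
    then show "(case ?ps ! i of (b, d, a, e) \<Rightarrow> real a / real e) \<noteq>
      (case ?ps ! (i + 1) of (b, d, a, e) \<Rightarrow> real a / real e)"
      using exponent_less[of i] by force
  qed
qed

end

lemma (in simple_graph) onion_decomposition_unique:
  assumes "onion_decomposition H Js" "onion_decomposition H Ks"
  shows "Js = Ks"
proof -
  interpret J: onion H Js by unfold_locales (rule assms)
  interpret K: onion H Ks by unfold_locales (rule assms)
  have eq: "Js ! t = Ks ! t" if "t < length Js" "t < length Ks" for t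
    using that
  proof (induction t)
    case (Suc t)
    then have "onion_step H (Js ! t) (Js ! Suc t)" "onion_step H (Js ! t) (Ks ! Suc t)"
      using J.step[of t] K.step[of t] by simp_all
    then show ?case
      using onion_step_unique J.induced_nth[of t] Suc by simp
  qed (simp add: J.first K.first)
  \<comment> \<open>If one run were a proper initial part of the other, the longer one would take a
    step from \<open>H\<close>, above which there is no further subgraph of
    \<open>H\<close>.\<close>
  have False if o: "onion H As" "onion H Bs" "length As < length Bs"
    "\<And>t. t < length As \<Longrightarrow> t < length Bs \<Longrightarrow> As ! t = Bs ! t" for As Bs
  proof -
    interpret A: onion H As by (rule o)
    interpret B: onion H Bs by (rule o)
    let ?l = "length As - 1"
    have "As ! ?l = H" using A.last A.nonempty by (simp add: last_conv_nth)
    then have "Bs ! ?l = H" using o(3) o(4)[of ?l] A.nonempty by simp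
    moreover have "?l + 1 < length Bs" using o(3) A.nonempty by (simp add: Suc_leI)
    ultimately show False using B.psubset_nth[of ?l] B.sub_nth[of "?l + 1"] by auto
  qed
  then have "length Js = length Ks"
    using J.onion_axioms K.onion_axioms eq by (metis linorder_neqE_nat)
  then show ?thesis using eq by (auto intro: nth_equalityI)
qed

section \<open>Balanced distributions of tokens\<close>

text \<open>\<open>X e v\<close> is the number of tokens that \<open>e\<close> gives to
  \<open>v\<close>. The condition \<open>stable\<close> says that no move is left; its tolerance of
  one is due to the integrality of the tokens.\<close>

locale balanced_tokens = simple_graph +
  fixes N :: nat and X :: "nat set \<Rightarrow> nat \<Rightarrow> nat" and load :: "nat \<Rightarrow> nat"
  assumes tokens: "e \<in> H \<Longrightarrow> (\<Sum>v\<in>e. X e v) = N"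
    and load: "load v = (\<Sum>e\<in>{e \<in> H. v \<in> e}. X e v)"
    and stable: "e \<in> H \<Longrightarrow> u \<in> e \<Longrightarrow> v \<in> e \<Longrightarrow> 0 < X e u \<Longrightarrow> load u \<le> load v + 1"
    and N_large: "card (V H) ^ 3 < N"
begin

definition present :: "nat \<Rightarrow> bool" where
  "present r \<longleftrightarrow> (\<exists>v\<in>V H. load v = r)"

text \<open>Positivity matters because the subtraction is truncated. A cut need not be an occurring
  load: the starting value above all loads is one as well.\<close>

definition cut :: "nat \<Rightarrow> bool" where
  "cut r \<longleftrightarrow> 0 < r \<and> \<not> present (r - 1)"

definition level :: "nat \<Rightarrow> graph" where
  "level r = {e \<in> H. \<forall>v\<in>e. r \<le> load v}"

lemma level_sub: "level r \<subseteq> H"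
  by (auto simp: level_def)

lemma level_antimono: "r \<le> s \<Longrightarrow> level s \<subseteq> level r"
  by (auto simp: level_def)

lemma finite_edge: "e \<in> H \<Longrightarrow> finite e"
  using card_edge by (metis card.infinite zero_neq_numeral)

lemma edge_sub_V: "e \<in> J \<Longrightarrow> e \<subseteq> V J"
  by (auto simp: V_def)

text \<open>The edge has an endpoint \<open>w\<close> of load below \<open>r\<close>, and then at
  most \<open>r - 2\<close> since \<open>r - 1\<close> does not occur. A token at \<open>v\<close>
  would force the load of \<open>v\<close> down to at most \<open>r - 1\<close>.\<close>

lemma crossing_zero:
  assumes r: "cut r" and e: "e \<in> H" "e \<notin> level r" and v: "v \<in> e" "r \<le> load v"
  shows "X e v = 0"
proof (rule ccontr)
  assume "X e v \<noteq> 0"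
  obtain w where w: "w \<in> e" "load w < r" using e by (auto simp: level_def not_le)
  then have "w \<in> V H" using e by (auto simp: V_def)
  then have "load w \<noteq> r - 1" using r by (auto simp: cut_def present_def)
  moreover have "load v \<le> load w + 1" using stable e v w \<open>X e v \<noteq> 0\<close> by simp
  ultimately show False using v w by linarith
qed

text \<open>A vertex of load at least \<open>r\<close> holds a token of some edge, since
  \<open>r\<close> is positive; by \<open>crossing_zero\<close> this edge belongs to the level.
  Hence no such vertex is isolated in the level.\<close>

lemma V_level:
  assumes "cut r"
  shows "V (level r) = {v \<in> V H. r \<le> load v}"
proof
  show "V (level r) \<subseteq> {v \<in> V H. r \<le> load v}"
    by (auto simp: V_def level_def)
  show "{v \<in> V H. r \<le> load v} \<subseteq> V (level r)"
  proof safe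
    fix v assume v: "v \<in> V H" "r \<le> load v"
    then have "(\<Sum>e\<in>{e \<in> H. v \<in> e}. X e v) \<noteq> 0"
      using assms load[of v] by (simp add: cut_def)
    then obtain e where "e \<in> H" "v \<in> e" "X e v \<noteq> 0"
      by (metis (mono_tags, lifting) mem_Collect_eq sum.neutral)
    moreover from this have "e \<in> level r" using crossing_zero[OF assms, of e v] v by metis
    ultimately show "v \<in> V (level r)" by (auto simp: V_def)
  qed
qed

lemma induced_level: "induced_in H (level r)"
  by (auto simp: induced_in_def level_def V_def)

text \<open>Double counting of the tokens of the edges outside the level: by
  \<open>crossing_zero\<close> all of them lie on vertices outside the level.\<close>

lemma tokens_outside:
  assumes r: "cut r" and J: "J \<subseteq> H"
  shows "N * card (J - level r) =
    (\<Sum>v\<in>V J - V (level r). \<Sum>e\<in>{e \<in> J - level r. v \<in> e}. X e v)"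
proof -
  have "N * card (J - level r) = (\<Sum>e\<in>J - level r. \<Sum>v\<in>e. X e v)"
    using tokens J by (subst sum.cong[OF refl, of _ _ "\<lambda>_. N"]) auto
  also have "\<dots> = (\<Sum>e\<in>J - level r. \<Sum>v\<in>{v \<in> V J - V (level r). v \<in> e}. X e v)"
  proof (rule sum.cong[OF refl])
    fix e assume e: "e \<in> J - level r"
    then have eH: "e \<in> H" "e \<notin> level r" "e \<subseteq> V J" using J edge_sub_V by auto
    show "(\<Sum>v\<in>e. X e v) = (\<Sum>v\<in>{v \<in> V J - V (level r). v \<in> e}. X e v)"
      using eH crossing_zero[OF r eH(1,2)] finite_edge
      by (intro sum.mono_neutral_right) (auto simp: V_level[OF r])
  qed
  also have "\<dots> = (\<Sum>v\<in>V J - V (level r). \<Sum>e\<in>{e \<in> J - level r. v \<in> e}. X e v)"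
    using J finite_sub finite_V by (intro sum.swap_restrict) auto
  finally show ?thesis .
qed

lemma tokens_outside_le:
  assumes r: "cut r" and J: "J \<subseteq> H"
  shows "N * card (J - level r) \<le> (\<Sum>v\<in>V J - V (level r). load v)"
  unfolding tokens_outside[OF assms]
proof (rule sum_mono)
  fix v show "(\<Sum>e\<in>{e \<in> J - level r. v \<in> e}. X e v) \<le> load v"
    unfolding load[of v] using J finite_H by (intro sum_mono2) auto
qed

text \<open>For a general \<open>J\<close> the new vertices may also hold tokens of edges not in
  \<open>J\<close>. Here they do not: an edge outside \<open>level r\<close> pays nothing to a
  vertex of load at least \<open>r\<close>, and an edge of \<open>level s\<close> does not contain
  the vertices in question.\<close>

lemma tokens_between:
  assumes r: "cut r" and s: "cut s"
  shows "N * card (level r - level s) = (\<Sum>v\<in>V (level r) - V (level s). load v)"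
  unfolding tokens_outside[OF s level_sub]
proof (rule sum.cong[OF refl])
  fix v assume v: "v \<in> V (level r) - V (level s)"
  then have "r \<le> load v" using V_level[OF r] by simp
  show "(\<Sum>e\<in>{e \<in> level r - level s. v \<in> e}. X e v) = load v"
    unfolding load[of v]
  proof (intro sum.mono_neutral_left ballI)
    fix e assume e: "e \<in> {e \<in> H. v \<in> e} - {e \<in> level r - level s. v \<in> e}"
    then have "e \<notin> level s" using v by (auto simp: V_def)
    then show "X e v = 0" using e crossing_zero[OF r, of e v] \<open>r \<le> load v\<close> by blast
  qed (use finite_H level_sub in auto)
qed

text \<open>All load values between the smallest and the largest one in a layer occur, so the loads in it
  differ by less than \<open>|V H|\<close>. Hence its density is maximal up to \<open>|V H| / N < 1 / |V H|\<^sup>2\<close>, and two distinct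
  densities differ by at least \<open>1 / |V H|\<^sup>2\<close>.\<close>

lemma onion_step_level:
  assumes s: "cut s" and r: "cut r" "present r" and rs: "r < s"
    and between: "\<And>x. r < x \<Longrightarrow> x < s \<Longrightarrow> \<not> (cut x \<and> present x)"
  shows "onion_step H (level s) (level r)"
proof -
  let ?S = "level s" and ?J = "level r"
  define C where "C = V ?J - V ?S"
  define c where "c = card (?J - ?S)"
  define d where "d = card C"
  define top where "top = Max (load ` C)"
  have C: "C = {v \<in> V H. r \<le> load v \<and> load v < s}"
    by (auto simp: C_def V_level s r)
  have finC: "finite C" using finite_V by (simp add: C)
  obtain v0 where "v0 \<in> C" using r rs by (auto simp: C present_def)
  then have Cne: "C \<noteq> {}" by auto
  have dpos: "0 < d" using Cne finC by (simp add: d_def card_gt_0_iff)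
  have rpos: "0 < r" using r by (simp add: cut_def)
  have "top \<in> load ` C" unfolding top_def using finC Cne by (intro Max_in) auto
  then have top: "r \<le> top" "top < s" "present top" by (auto simp: C present_def)
  \<comment> \<open>Downward induction from \<open>top\<close>: if \<open>x\<close> were absent,
    \<open>Suc x\<close> would be a present cut strictly between \<open>r\<close> and
    \<open>s\<close>.\<close>
  have "present x" if "r \<le> x" "x \<le> top" for x
    using that(2)
  proof (induction x rule: inc_induct)
    case (step x)
    then show ?case using between[of "Suc x"] that(1) top(2) by (auto simp: cut_def)
  qed (rule top)
  then have "{r..top} \<subseteq> load ` C"
    using top by (force simp: C present_def)
  then have "card {r..top} \<le> d"
    unfolding d_def using finC by (meson card_image_le card_mono finite_imageI le_trans)
  then have spread: "top < r + d" by simp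
  have below: "load v \<le> top" if "v \<in> V H" "load v < s" for v
    using that top(1) finC by (cases "r \<le> load v") (auto simp: top_def C intro!: Max_ge)
  have Nc: "N * c = (\<Sum>v\<in>C. load v)"
    unfolding c_def C_def by (rule tokens_between) (fact s r)+
  have "d * r \<le> (\<Sum>v\<in>C. load v)"
    using sum_bounded_below[of C r load] by (simp add: d_def) (simp add: C)
  then have dr: "d * r \<le> N * c" by (simp add: Nc)
  have cpos: "0 < c" using dr dpos rpos by (cases c) auto
  have SJ: "?S \<subset> ?J" using level_antimono[of r s] rs cpos by (auto simp: c_def)
  define k where "k = card (V H)"
  have finVH: "finite (V H)" using finite_V by auto
  have "d \<le> k" unfolding d_def k_def using finVH by (intro card_mono) (auto simp: C)
  have le: "card (K - ?S) * d \<le> c * card (V K - V ?S)" if K: "?S \<subset> K" "K \<subseteq> H" for K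
  proof (rule ccontr)
    define cK where "cK = card (K - ?S)"
    define dK where "dK = card (V K - V ?S)"
    assume "\<not> card (K - ?S) * d \<le> c * card (V K - V ?S)"
    \<comment> \<open>The two products are integers, so a violation is by at least one;
      multiplication by \<open>N\<close> turns it into a gap of at least \<open>N\<close>.\<close>
    then have "c * dK + 1 \<le> cK * d" by (simp add: cK_def dK_def)
    then have "N * (c * dK + 1) \<le> N * (cK * d)" by (rule mult_le_mono2)
    moreover have "N * cK \<le> (\<Sum>v\<in>V K - V ?S. load v)"
      unfolding cK_def using s K by (intro tokens_outside_le) auto
    moreover have "(\<Sum>v\<in>V K - V ?S. load v) \<le> dK * top"
    proof -
      have "load v \<le> top" if "v \<in> V K - V ?S" for v
        using that V_mono[OF K(2)] below by (auto simp: V_level s)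
      then show ?thesis using sum_bounded_above[of "V K - V ?S" load top] by (simp add: dK_def)
    qed
    ultimately have "N * (c * dK + 1) \<le> dK * top * d"
      by (metis (no_types, lifting) le_trans mult.assoc mult_le_mono1)
    moreover have "d * r * dK \<le> N * c * dK" using dr by simp
    moreover have "N * (c * dK + 1) = N + N * c * dK" by (simp add: algebra_simps)
    ultimately have "N + d * r * dK \<le> dK * top * d" by linarith
    \<comment> \<open>The new vertices of \<open>K\<close> carry at most \<open>top < r + d\<close>
      tokens each, while the layer averages at least \<open>r\<close>. After cancellation only
      \<open>dK * d * d\<close> is left to cover the gap of \<open>N\<close>.\<close>
    moreover have "dK * top * d \<le> dK * (r + d) * d" using spread by simp
    ultimately have "N \<le> dK * d * d" by (simp add: algebra_simps)
    moreover have "dK \<le> k" unfolding dK_def k_def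
      using finVH V_mono[OF K(2)] by (intro card_mono) auto
    then have "dK * d * d \<le> k ^ 3"
      using \<open>d \<le> k\<close> by (simp add: power3_eq_cube mult_le_mono)
    ultimately show False using N_large by (simp add: k_def)
  qed
  then have max: "rho_maximizer H ?S ?J"
    unfolding rho_maximizer_iff[OF induced_level]
    using SJ level_sub by (simp add: c_def d_def C_def)
  \<comment> \<open>Vertices gained beyond \<open>?J\<close> carry at most \<open>r - 1\<close>
    tokens each, whereas the layer averages at least \<open>r\<close>; a larger graph is therefore
    strictly less dense.\<close>
  have False if K: "rho_maximizer H ?S K" "?J \<subset> K" for K
  proof -
    note KH = rho_maximizerD[OF K(1)]
    define f where "f = card (K - ?J)"
    define e where "e = card (V K - V ?J)"
    have epos: "0 < e" unfolding e_def using induced_level K KH by (intro card_new_vertices_pos)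
    have "c * card (V K - V ?S) \<le> card (K - ?S) * d"
      using K(1) SJ level_sub unfolding rho_maximizer_iff[OF induced_level] c_def d_def C_def by simp
    moreover have "card (K - ?S) = f + c"
      unfolding f_def c_def using KH K SJ finite_sub by (intro card_Diff_chain) auto
    moreover have "card (V K - V ?S) = e + d"
      unfolding e_def d_def C_def using KH K SJ finite_V by (intro card_Diff_chain V_mono) auto
    ultimately have "c * e \<le> f * d" by (simp add: algebra_simps)
    then have "N * c * e \<le> N * f * d" by (simp add: mult.assoc)
    moreover have "N * f \<le> (\<Sum>v\<in>V K - V ?J. load v)"
      unfolding f_def using r KH by (intro tokens_outside_le) auto
    moreover have "(\<Sum>v\<in>V K - V ?J. load v) \<le> e * (r - 1)"
    proof -
      have "load v \<le> r - 1" if "v \<in> V K - V ?J" for v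
        using that V_mono[OF KH(2)] by (auto simp: V_level r)
      then show ?thesis using sum_bounded_above[of "V K - V ?J" load "r - 1"] by (simp add: e_def)
    qed
    ultimately have "N * c * e \<le> e * (r - 1) * d"
      by (meson le_trans mult_le_mono1)
    moreover have "d * r * e \<le> N * c * e" using dr by simp
    ultimately have "d * r * e \<le> e * (r - 1) * d" by linarith
    then have "(d * e) * r \<le> (d * e) * (r - 1)" by (simp add: mult_ac)
    then show False using dpos epos rpos by (simp add: mult_le_cancel1)
  qed
  with max show ?thesis by (auto simp: onion_step_def)
qed

text \<open>An edge at a vertex of load 0 gives all \<open>N > 1\<close> tokens to its other
  endpoint, against \<open>stable\<close>. This makes the smallest load a cut, so that the last
  level is all of \<open>H\<close>.\<close>

lemma load_pos:
  assumes "v \<in> V H"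
  shows "0 < load v"
proof (rule ccontr)
  assume "\<not> 0 < load v"
  then have l0: "load v = 0" by simp
  obtain e where e: "e \<in> H" "v \<in> e" using assms by (auto simp: V_def)
  then obtain a b where "e = {a, b}" "a \<noteq> b" using card_edge by (meson card_2_iff)
  then obtain w where w: "e = {v, w}" "v \<noteq> w" using e by auto
  have le: "X e u \<le> load u" if "u \<in> e" for u
    unfolding load[of u] using that e finite_H by (intro member_le_sum) auto
  have "X e v + X e w = N" using tokens[OF e(1)] w by simp
  then have "X e w = N" using le[of v] w l0 by simp
  have "0 < card (V H)" using assms finite_V[of H] by (auto simp: card_gt_0_iff)
  then have N: "1 < N" using N_large by (metis Suc_leI less_one linorder_neqE_nat not_less_eq one_le_power order_less_le_trans One_nat_def)
  then have "load w \<le> load v + 1" using stable[of e w v] e w \<open>X e w = N\<close> by simp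
  then show False using le[of w] w \<open>X e w = N\<close> l0 N by simp
qed

text \<open>Starting the range at 1 supplies the positivity in \<open>cut\<close>. The reversal
  lists the layers with highest loads, which are the densest ones, first.\<close>

definition thresholds :: "nat \<Rightarrow> nat list" where
  "thresholds R = filter (\<lambda>r. present r \<and> \<not> present (r - 1)) (rev [1..<Suc R])"

lemma onion_decomposition_levels:
  assumes ne: "H \<noteq> {}" and R: "\<And>v. v \<in> V H \<Longrightarrow> load v + 1 < R"
  shows "onion_decomposition H (map level (R # thresholds R))"
proof -
  define rs where "rs = thresholds R"
  have set_rs: "set rs = {r. cut r \<and> present r}"
    using R by (force simp: rs_def thresholds_def cut_def present_def)
  have "sorted_wrt (>) (rev [1..<Suc R])"
    by (simp add: sorted_wrt_rev del: upt_Suc)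
  then have "sorted_wrt (>) rs"
    unfolding rs_def thresholds_def by (rule sorted_wrt_filter)
  moreover have "x < R" if x: "x \<in> set rs" for x
  proof -
    obtain v where "v \<in> V H" "load v = x" using x set_rs by (auto simp: present_def)
    then show ?thesis using R[of v] by simp
  qed
  ultimately have sorted: "sorted_wrt (>) (R # rs)" by simp
  let ?B = "R # rs"
  have desc: "?B ! j \<le> ?B ! i" if "i \<le> j" "j < length ?B" for i j
    using sorted_wrt_nth_less[OF sorted, of i j] that by (cases "i = j") auto
  have edge_ne: "e \<noteq> {}" if "e \<in> H" for e using card_edge[OF that] by auto
  then obtain v0 where v0: "v0 \<in> V H" using ne unfolding V_def by (metis UnionI all_not_in_conv)
  have "0 < R" using R[OF v0] by simp
  \<comment> \<open>The margin of two above every load makes \<open>R - 1\<close> absent as well, so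
    the empty graph is itself the level of a cut.\<close>
  have cutR: "cut R" using R \<open>0 < R\<close> by (force simp: cut_def present_def)
  \<comment> \<open>The smallest load is a threshold whose level is \<open>H\<close>; since the
    thresholds decrease, the last one is at most \<open>l\<close>.\<close>
  define l where "l = Min (load ` V H)"
  have fin: "finite (load ` V H)" using finite_V by simp
  have l_le: "l \<le> load v" if "v \<in> V H" for v using fin that by (simp add: l_def)
  have "l \<in> load ` V H" unfolding l_def using fin v0 by (intro Min_in) auto
  then have "present l" "0 < l" using load_pos by (auto simp: present_def)
  moreover from this have "cut l" using l_le by (force simp: cut_def present_def)
  ultimately have "l \<in> set rs" using set_rs by simp
  then obtain i where i: "i < length ?B" "?B ! i = l" by (metis in_set_conv_nth list.set_intros(2))
  have "last ?B = ?B ! (length ?B - 1)" by (rule last_conv_nth) simp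
  then have "last ?B \<le> l"
    using desc[of i "length ?B - 1"] i by simp
  then have "level (last ?B) = H"
    using l_le by (force simp: level_def V_def)
  then have "last (map level ?B) = H" by (simp only: last_map list.discI not_False_eq_True)
  moreover have "e \<notin> level R" for e
  proof
    assume "e \<in> level R"
    moreover from this obtain v where "v \<in> e" using edge_ne by (auto simp: level_def)
    ultimately have "v \<in> V H" "R \<le> load v" by (auto simp: level_def V_def)
    then show False using R[of v] by simp
  qed
  then have "level R = {}" by blast
  moreover have "onion_step H (map level ?B ! t) (map level ?B ! (t + 1))"
    if t: "t + 1 < length ?B" for t
  proof -
    have mem: "x \<in> set rs" if "0 < j" "j < length ?B" "x = ?B ! j" for x j
      using that by (cases j) auto
    have "onion_step H (level (?B ! t)) (level (?B ! (t + 1)))"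
    proof (rule onion_step_level)
      show "cut (?B ! t)"
        using mem[of t "?B ! t"] t cutR set_rs by (cases "t = 0") auto
      show "cut (?B ! (t + 1))" "present (?B ! (t + 1))"
        using mem[of "t + 1" "?B ! (t + 1)"] t set_rs by auto
      show "?B ! (t + 1) < ?B ! t"
        using sorted_wrt_nth_less[OF sorted, of t "t + 1"] t by simp
      fix x assume x: "?B ! (t + 1) < x" "x < ?B ! t"
      show "\<not> (cut x \<and> present x)"
      proof
        assume "cut x \<and> present x"
        then obtain s where s: "s < length ?B" "?B ! s = x"
          using set_rs by (metis in_set_conv_nth list.set_intros(2) mem_Collect_eq)
        then show False
          using desc[of s t] desc[of "t + 1" s] x t by (cases "s \<le> t") auto
      qed
    qed
    then show ?thesis using t by (simp only: nth_map)
  qed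
  ultimately show ?thesis
    unfolding rs_def onion_decomposition_def by simp
qed

end

section \<open>Time-bounded total correctness\<close>

text \<open>Total correctness with an upper bound on time. Execution is deterministic, so the
  existence of one suitable run describes the behaviour of the program.\<close>

definition runs :: "com \<Rightarrow> state \<Rightarrow> nat \<Rightarrow> (state \<Rightarrow> bool) \<Rightarrow> bool" where
  "runs c s T Q \<longleftrightarrow> (\<exists>t s'. exec c s t s' \<and> t \<le> T \<and> Q s')"

lemma runs_mono: "runs c s T P \<Longrightarrow> T \<le> T' \<Longrightarrow> (\<And>s'. P s' \<Longrightarrow> Q s') \<Longrightarrow> runs c s T' Q"
  unfolding runs_def by (meson le_trans)

lemma runs_Seq:
  assumes "runs c s T P" "\<And>s'. P s' \<Longrightarrow> runs d s' T' Q"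
  shows "runs (Seq c d) s (T + T') Q"
  using assms unfolding runs_def by (meson add_mono exec.Seq)

lemma runs_Cond:
  assumes "bval b s \<Longrightarrow> runs c s T Q" "\<not> bval b s \<Longrightarrow> runs d s T Q"
  shows "runs (Cond b c d) s (1 + bcost b + T) Q"
  using assms unfolding runs_def
  by (meson add_le_cancel_left exec.CondFalse exec.CondTrue)

lemma runs_While_True:
  assumes "bval b s" "runs c s T P" "\<And>s'. P s' \<Longrightarrow> runs (While b c) s' T' Q"
  shows "runs (While b c) s (1 + bcost b + T + T') Q"
proof -
  obtain t s' where s': "exec c s t s'" "t \<le> T" "P s'" using assms(2) unfolding runs_def by blast
  obtain t' s'' where "exec (While b c) s' t' s''" "t' \<le> T'" "Q s''"
    using assms(3)[OF s'(3)] unfolding runs_def by blast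
  then show ?thesis
    unfolding runs_def using exec.WhileTrue[OF assms(1) s'(1)] s'(2) by (meson add_mono le_refl)
qed

lemma runs_While_False: "\<not> bval b s \<Longrightarrow> Q s \<Longrightarrow> runs (While b c) s (1 + bcost b) Q"
  unfolding runs_def using exec.WhileFalse by blast

text \<open>The variant \<open>f\<close> yields termination and at the same time bounds the number
  of rounds, as required for the balancing loop, whose number of rounds is not fixed in
  advance.\<close>

lemma runs_While:
  assumes "\<And>s. I s \<Longrightarrow> bval b s \<Longrightarrow> runs c s T (\<lambda>s'. I s' \<and> f s' < f s)" and "I s"
  shows "runs (While b c) s (f s * (1 + bcost b + T) + (1 + bcost b)) (\<lambda>s'. I s' \<and> \<not> bval b s')"
  using assms(2)
proof (induction "f s" arbitrary: s rule: less_induct)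
  case less
  show ?case
  proof (cases "bval b s")
    case True
    let ?B = "1 + bcost b + T"
    have "runs (While b c) s (?B + ((f s - 1) * ?B + (1 + bcost b))) (\<lambda>s'. I s' \<and> \<not> bval b s')"
    proof (rule runs_While_True[OF True assms(1)[OF less.prems True]])
      fix s' assume s': "I s' \<and> f s' < f s"
      show "runs (While b c) s' ((f s - 1) * ?B + (1 + bcost b)) (\<lambda>s'. I s' \<and> \<not> bval b s')"
      proof (rule runs_mono)
        show "runs (While b c) s' (f s' * ?B + (1 + bcost b)) (\<lambda>s'. I s' \<and> \<not> bval b s')"
          using less.hyps s' by blast
        have "f s' * ?B \<le> (f s - 1) * ?B" using s' by (intro mult_le_mono1) auto
        then show "f s' * ?B + (1 + bcost b) \<le> (f s - 1) * ?B + (1 + bcost b)" by simp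
      qed
    qed
    moreover have "0 < f s"
      using assms(1)[OF less.prems True] by (auto simp: runs_def)
    then have "?B + ((f s - 1) * ?B + (1 + bcost b)) = f s * ?B + (1 + bcost b)"
      by (cases "f s") auto
    ultimately show ?thesis by metis
  next
    case False
    then have "runs (While b c) s (1 + bcost b) (\<lambda>s'. I s' \<and> \<not> bval b s')"
      using less.prems by (intro runs_While_False) auto
    then show ?thesis by (rule runs_mono) auto
  qed
qed

text \<open>For counting loops: the invariant carries the number of completed rounds, so the exit
  state satisfies it at exactly \<open>n\<close>.\<close>

lemma runs_For:
  assumes "\<And>k s. k < n \<Longrightarrow> I k s \<Longrightarrow> bval b s" "\<And>s. I n s \<Longrightarrow> \<not> bval b s"
    and "\<And>k s. k < n \<Longrightarrow> I k s \<Longrightarrow> runs c s T (I (Suc k))" and "I 0 s"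
  shows "runs (While b c) s (n * (1 + bcost b + T) + (1 + bcost b)) (I n)"
proof -
  have "runs (While b c) s ((n - k) * (1 + bcost b + T) + (1 + bcost b)) (I n)"
    if "k \<le> n" "I k s" for k s
    using that
  proof (induction k arbitrary: s rule: inc_induct)
    case base
    then show ?case using runs_While_False[of b s "I n" c] assms(2) by simp
  next
    case (step k)
    have "runs (While b c) s (1 + bcost b + T +
      ((n - Suc k) * (1 + bcost b + T) + (1 + bcost b))) (I n)"
      using step assms(1,3) by (intro runs_While_True[where P = "I (Suc k)"]) auto
    moreover have "n - k = Suc (n - Suc k)" using step by simp
    ultimately show ?case by (simp add: algebra_simps)
  qed
  from this[of 0 s] assms(4) show ?thesis by simp
qed

fun loop_free :: "com \<Rightarrow> bool" where
  "loop_free (Seq c d) \<longleftrightarrow> loop_free c \<and> loop_free d"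
| "loop_free (Cond b c d) \<longleftrightarrow> loop_free c \<and> loop_free d"
| "loop_free (While b c) \<longleftrightarrow> False"
| "loop_free _ \<longleftrightarrow> True"

text \<open>Symbolic execution of straight-line code, which reduces the verification of a loop body
  to rewriting. The value at \<open>While\<close> is a dummy, excluded by
  \<open>loop_free\<close>.\<close>

fun effect :: "com \<Rightarrow> state \<Rightarrow> state" where
  "effect Skip s = s"
| "effect (Assign x e) s = s\<lparr>var := (var s)(x := aval e s)\<rparr>"
| "effect (Store a i e) s = s\<lparr>arr := (arr s)(a := (arr s a)(aval i s := aval e s))\<rparr>"
| "effect (Seq c d) s = effect d (effect c s)"
| "effect (Cond b c d) s = (if bval b s then effect c s else effect d s)"
| "effect (While b c) s = s"

fun max_cost :: "com \<Rightarrow> nat" where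
  "max_cost Skip = 1"
| "max_cost (Assign x e) = 1 + acost e"
| "max_cost (Store a i e) = 1 + acost i + acost e"
| "max_cost (Seq c d) = max_cost c + max_cost d"
| "max_cost (Cond b c d) = 1 + bcost b + max (max_cost c) (max_cost d)"
| "max_cost (While b c) = 0"

lemma runs_effect: "loop_free c \<Longrightarrow> runs c s (max_cost c) (\<lambda>s'. s' = effect c s)"
proof (induction c arbitrary: s)
  case (Seq c d)
  then show ?case by (auto intro!: runs_Seq)
next
  case (Cond b c d)
  have "runs (Cond b c d) s (1 + bcost b + max (max_cost c) (max_cost d))
    (\<lambda>s'. s' = effect (Cond b c d) s)"
  proof (rule runs_Cond)
    assume "bval b s"
    then show "runs c s (max (max_cost c) (max_cost d)) (\<lambda>s'. s' = effect (Cond b c d) s)"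
      using Cond by (intro runs_mono[OF Cond.IH(1)]) auto
  next
    assume "\<not> bval b s"
    then show "runs d s (max (max_cost c) (max_cost d)) (\<lambda>s'. s' = effect (Cond b c d) s)"
      using Cond by (intro runs_mono[OF Cond.IH(2)]) auto
  qed
  then show ?case by simp
next
  case (Assign x e) show ?case unfolding runs_def using exec.Assign by fastforce
next
  case (Store a i e) show ?case unfolding runs_def using exec.Store by fastforce
next
  case Skip show ?case unfolding runs_def using exec.Skip by fastforce
qed simp

lemma runs_loop_free: "loop_free c \<Longrightarrow> Q (effect c s) \<Longrightarrow> runs c s (max_cost c) Q"
  using runs_effect[of c s] by (rule runs_mono) auto

section \<open>Polynomial bounds\<close>

definition poly_bounded :: "(nat \<Rightarrow> nat) \<Rightarrow> bool" where
  "poly_bounded f \<longleftrightarrow> (\<exists>p :: nat poly. \<forall>m. f m \<le> poly p m)"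

lemma poly_bounded_const: "poly_bounded (\<lambda>_. c)"
  unfolding poly_bounded_def by (intro exI[of _ "[:c:]"]) simp

lemma poly_bounded_id: "poly_bounded (\<lambda>m. m)"
  unfolding poly_bounded_def by (intro exI[of _ "[:0, 1:]"]) simp

lemma poly_bounded_add: "poly_bounded f \<Longrightarrow> poly_bounded g \<Longrightarrow> poly_bounded (\<lambda>m. f m + g m)"
  unfolding poly_bounded_def by (metis add_mono poly_add)

lemma poly_bounded_mult: "poly_bounded f \<Longrightarrow> poly_bounded g \<Longrightarrow> poly_bounded (\<lambda>m. f m * g m)"
  unfolding poly_bounded_def by (metis mult_le_mono poly_mult)

lemma poly_bounded_power: "poly_bounded f \<Longrightarrow> poly_bounded (\<lambda>m. f m ^ k)"
  unfolding poly_bounded_def by (metis power_mono poly_power zero_le)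

lemmas poly_bounded_intros = poly_bounded_const poly_bounded_id poly_bounded_add
  poly_bounded_mult poly_bounded_power

section \<open>Balancing by a program\<close>

abbreviation (input) "v_out_len \<equiv> 1 :: nat"
abbreviation (input) "v_edges \<equiv> 2 :: nat"
abbreviation (input) "v_i \<equiv> 3 :: nat"
abbreviation (input) "v_N \<equiv> 4 :: nat"
abbreviation (input) "v_square \<equiv> 5 :: nat"
abbreviation (input) "v_R \<equiv> 6 :: nat"
abbreviation (input) "v_j \<equiv> 7 :: nat"
abbreviation (input) "v_r \<equiv> 8 :: nat"

abbreviation (input) "a_in \<equiv> 0 :: nat"
abbreviation (input) "a_out \<equiv> 1 :: nat"
abbreviation (input) "a_load \<equiv> 2 :: nat"
abbreviation (input) "a_fst \<equiv> 3 :: nat"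
abbreviation (input) "a_snd \<equiv> 4 :: nat"
abbreviation (input) "a_present \<equiv> 5 :: nat"
abbreviation (input) "a_seen \<equiv> 6 :: nat"

text \<open>Cell 0 holds the number of edges, so edge number \<open>i\<close>, counted from 0,
  occupies the cells \<open>2 * i + 1\<close> and \<open>2 * i + 2\<close>; the doubling is done by
  addition.\<close>

abbreviation (input) "first_end \<equiv> Cell a_in (Plus (Const 1) (Plus (Var v_i) (Var v_i)))"
abbreviation (input) "second_end \<equiv> Cell a_in (Plus (Const 2) (Plus (Var v_i) (Var v_i)))"
abbreviation (input) "more_edges \<equiv> Less (Var v_i) (Var v_edges)"
abbreviation (input) "inc x \<equiv> Assign x (Plus (Var x) (Const 1))"

fun block :: "com list \<Rightarrow> com" where
  "block [] = Skip"
| "block [c] = c"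
| "block (c # d # cs) = Seq c (block (d # cs))"

text \<open>Multiplication by repeated addition: one loop builds the square of the number of edges,
  the next adds it eight times per round, and a final increment completes \<open>N\<close>.\<close>

definition square_body :: com where
  "square_body = block [Assign v_square (Plus (Var v_square) (Var v_edges)), inc v_i]"

definition cube_body :: com where
  "cube_body = block
    [Assign v_N (Plus (Var v_N) (Var v_square)), Assign v_N (Plus (Var v_N) (Var v_square)),
     Assign v_N (Plus (Var v_N) (Var v_square)), Assign v_N (Plus (Var v_N) (Var v_square)),
     Assign v_N (Plus (Var v_N) (Var v_square)), Assign v_N (Plus (Var v_N) (Var v_square)),
     Assign v_N (Plus (Var v_N) (Var v_square)), Assign v_N (Plus (Var v_N) (Var v_square)),
     inc v_i]"

text \<open>Initially every edge gives all its tokens to its first endpoint. \<open>v_R\<close>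
  starts at 2 and gains \<open>N\<close> per edge, which leaves it at least two above every possible
  load.\<close>

definition fill_body :: com where
  "fill_body = block
    [Store a_fst (Var v_i) (Var v_N),
     Store a_load first_end (Plus (Cell a_load first_end) (Var v_N)),
     Assign v_R (Plus (Var v_R) (Var v_N)),
     inc v_i]"

text \<open>The search position is reset because a move changes two loads and can make tokens of
  edges already passed movable again.\<close>

definition move :: "nat \<Rightarrow> nat \<Rightarrow> aexp \<Rightarrow> aexp \<Rightarrow> com" where
  "move x y u w = block
    [Store x (Var v_i) (Minus (Cell x (Var v_i)) (Const 1)),
     Store y (Var v_i) (Plus (Cell y (Var v_i)) (Const 1)),
     Store a_load u (Minus (Cell a_load u) (Const 1)),
     Store a_load w (Plus (Cell a_load w) (Const 1)),
     Assign v_i (Const 0)]"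

definition movable :: "nat \<Rightarrow> aexp \<Rightarrow> aexp \<Rightarrow> bexp" where
  "movable x u w = BAnd (Less (Plus (Cell a_load w) (Const 1)) (Cell a_load u))
    (Less (Const 0) (Cell x (Var v_i)))"

definition balance_body :: com where
  "balance_body =
    Cond (movable a_fst first_end second_end) (move a_fst a_snd first_end second_end)
      (Cond (movable a_snd second_end first_end) (move a_snd a_fst second_end first_end)
        (inc v_i))"

text \<open>A table indexed by load values replaces sorting; the loads are polynomially bounded, so
  all values can be tried later.\<close>

definition mark_body :: com where
  "mark_body = block
    [Store a_present (Cell a_load first_end) (Const 1),
     Store a_present (Cell a_load second_end) (Const 1),
     inc v_i]"

definition balance_prog :: com where
  "balance_prog =
    Seq (Assign v_edges (Cell a_in (Const 0)))
    (Seq (While more_edges square_body)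
    (Seq (Assign v_i (Const 0))
    (Seq (While more_edges cube_body)
    (Seq (block [inc v_N, Assign v_i (Const 0), Assign v_R (Const 2)])
    (Seq (While more_edges fill_body)
    (Seq (Assign v_i (Const 0))
    (Seq (While more_edges balance_body)
    (Seq (Assign v_i (Const 0)) (While more_edges mark_body)))))))))"

section \<open>Loads in terms of edge indices\<close>

definition weight :: "nat \<Rightarrow> (nat \<Rightarrow> nat) \<Rightarrow> (nat \<Rightarrow> nat) \<Rightarrow> (nat \<Rightarrow> nat) \<Rightarrow> (nat \<Rightarrow> nat) \<Rightarrow> nat \<Rightarrow> nat" where
  "weight m a b x y w = (\<Sum>i<m. (if a i = w then x i else 0) + (if b i = w then y i else 0))"

lemma weight_swap: "weight m a b x y = weight m b a y x"
  by (simp add: weight_def add.commute fun_eq_iff)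

lemma weight_move:
  assumes "i < m" "a i \<noteq> b i" "0 < x i"
  shows "weight m a b (x(i := x i - 1)) (y(i := y i + 1)) =
    (weight m a b x y)(a i := weight m a b x y (a i) - 1, b i := weight m a b x y (b i) + 1)"
proof
  fix w
  let ?r = "\<Sum>j\<in>{..<m} - {i}. (if a j = w then x j else 0) + (if b j = w then y j else 0)"
  have split: "weight m a b x' y' w = (if a i = w then x' i else 0) + (if b i = w then y' i else 0) + ?r"
    if "\<And>j. j \<noteq> i \<Longrightarrow> x' j = x j \<and> y' j = y j" for x' y'
  proof -
    have "(\<Sum>j\<in>{..<m} - {i}. (if a j = w then x' j else 0) + (if b j = w then y' j else 0)) = ?r"
      by (intro sum.cong refl) (simp add: that)
    then show ?thesis
      unfolding weight_def using assms(1) by (subst sum.remove[of _ i]) auto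
  qed
  have "weight m a b x y w = (if a i = w then x i else 0) + (if b i = w then y i else 0) + ?r"
    "weight m a b (x(i := x i - 1)) (y(i := y i + 1)) w =
     (if a i = w then x i - 1 else 0) + (if b i = w then y i + 1 else 0) + ?r"
    by (subst split; simp)+
  then show "weight m a b (x(i := x i - 1)) (y(i := y i + 1)) w =
    ((weight m a b x y)(a i := weight m a b x y (a i) - 1, b i := weight m a b x y (b i) + 1)) w"
    using assms by auto
qed

lemma weight_le:
  assumes "\<And>i. i < m \<Longrightarrow> x i + y i = N" "\<And>i. i < m \<Longrightarrow> a i \<noteq> b i"
  shows "weight m a b x y w \<le> N * m"
proof -
  have "weight m a b x y w \<le> (\<Sum>i<m. N)"
    unfolding weight_def using assms by (intro sum_mono) fastforce
  then show ?thesis by (simp add: mult.commute)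
qed

text \<open>With \<open>l u = l w + 2 + d\<close> the sum drops by
  \<open>2 * (d + 1)\<close>.\<close>

lemma sum_squares_move:
  fixes l :: "nat \<Rightarrow> nat"
  assumes "finite W" "u \<in> W" "w \<in> W" "l w + 1 < l u"
  shows "(\<Sum>v\<in>W. ((l(u := l u - 1, w := l w + 1)) v)\<^sup>2) < (\<Sum>v\<in>W. (l v)\<^sup>2)"
proof -
  have uw: "u \<noteq> w" using assms by auto
  have split: "(\<Sum>v\<in>W. (f v)\<^sup>2) = (f u)\<^sup>2 + (f w)\<^sup>2 + (\<Sum>v\<in>W - {u} - {w}. (f v)\<^sup>2)" for f :: "nat \<Rightarrow> nat"
    using assms uw by (simp add: sum.remove[of W u] sum.remove[of "W - {u}" w])
  obtain d where d: "l u = l w + 2 + d" using assms(4) by (metis add.assoc less_iff_Suc_add one_add_one add_Suc_right plus_1_eq_Suc add.commute)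
  have "(\<Sum>v\<in>W - {u} - {w}. ((l(u := l u - 1, w := l w + 1)) v)\<^sup>2) = (\<Sum>v\<in>W - {u} - {w}. (l v)\<^sup>2)"
    by (intro sum.cong) auto
  then show ?thesis
    unfolding split using uw by (simp add: d power2_eq_square algebra_simps)
qed

lemma nth_concat_pairs:
  assumes "i < length es"
  shows "concat (map (\<lambda>(u, v). [u, v]) es) ! (i + i) = fst (es ! i)"
    and "concat (map (\<lambda>(u, v). [u, v]) es) ! Suc (i + i) = snd (es ! i)"
  using assms by (induction es arbitrary: i) (auto simp: less_Suc_eq_0_disj split: prod.splits)

lemma length_concat_pairs: "length (concat (map (\<lambda>(u, v). [u, v]) es)) = length es + length es"
  by (induction es) auto

text \<open>A bound for the initial potential: at most \<open>2 * k\<close> vertices, each of load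
  at most \<open>N * k\<close> with \<open>N = 8 * k ^ 3 + 1\<close>, the factor
  \<open>k + 1\<close> of the lexicographic order, and \<open>k\<close> for the search
  position.\<close>

definition balance_loop_bound :: "nat \<Rightarrow> nat" where
  "balance_loop_bound k = 2 * k * ((8 * k ^ 3 + 1) * k)\<^sup>2 * (k + 1) + k"

text \<open>The parentheses follow the nesting of \<open>Seq\<close> in \<open>balance_prog\<close>,
  so that \<open>runs_Seq\<close> applies without rearranging the sum.\<close>

definition balance_time :: "nat \<Rightarrow> nat" where
  "balance_time k =
    max_cost (Assign v_edges (Cell a_in (Const 0))) +
    ((k * (1 + bcost more_edges + max_cost square_body) + (1 + bcost more_edges)) +
    (max_cost (Assign v_i (Const 0)) +
    ((k * (1 + bcost more_edges + max_cost cube_body) + (1 + bcost more_edges)) +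
    (max_cost (block [inc v_N, Assign v_i (Const 0), Assign v_R (Const 2)]) +
    ((k * (1 + bcost more_edges + max_cost fill_body) + (1 + bcost more_edges)) +
    (max_cost (Assign v_i (Const 0)) +
    ((balance_loop_bound k * (1 + bcost more_edges + max_cost balance_body) + (1 + bcost more_edges)) +
    (max_cost (Assign v_i (Const 0)) +
    (k * (1 + bcost more_edges + max_cost mark_body) + (1 + bcost more_edges))))))))))"

lemma poly_bounded_balance_time: "poly_bounded balance_time"
  unfolding balance_time_def balance_loop_bound_def by (intro poly_bounded_intros)

locale edge_list =
  fixes es :: "(nat \<times> nat) list"
  assumes distinct_edges: "distinct (map (\<lambda>(u, v). {u, v}) es)"
    and loopless: "(u, v) \<in> set es \<Longrightarrow> u \<noteq> v"
begin

definition H :: graph where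
  "H = set (map (\<lambda>(u, v). {u, v}) es)"

definition m :: nat where "m = length es"

definition a :: "nat \<Rightarrow> nat" where "a i = fst (es ! i)"

definition b :: "nat \<Rightarrow> nat" where "b i = snd (es ! i)"

text \<open>That is \<open>(2 * m)\<^sup>3 + 1\<close>, where \<open>2 * m\<close> bounds the number of vertices.\<close>

definition N :: nat where "N = 8 * m ^ 3 + 1"

definition input :: "nat list" where
  "input = length es # concat (map (\<lambda>(u, v). [u, v]) es)"

definition A :: "nat \<Rightarrow> nat" where "A = arr (init_state input) 0"

lemma A_simps: "A 0 = m" "i < m \<Longrightarrow> A (Suc (i + i)) = a i" "i < m \<Longrightarrow> A (Suc (Suc (i + i))) = b i"
  using nth_concat_pairs[of i es]
  by (auto simp: A_def init_state_def input_def m_def a_def b_def length_concat_pairs)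

lemma ends_neq: "i < m \<Longrightarrow> a i \<noteq> b i"
  using loopless by (simp add: a_def b_def m_def)

lemma H_eq: "H = (\<lambda>i. {a i, b i}) ` {..<m}"
  unfolding H_def m_def a_def b_def set_map
  by (auto simp: set_conv_nth case_prod_beta image_iff)

lemma edge_inj: "inj_on (\<lambda>i. {a i, b i}) {..<m}"
proof (rule inj_onI)
  fix i j assume "i \<in> {..<m}" "j \<in> {..<m}" "{a i, b i} = {a j, b j}"
  then show "i = j"
    using nth_eq_iff_index_eq[OF distinct_edges, of i j]
    by (simp add: m_def a_def b_def case_prod_beta)
qed

lemma card_H: "card H = m"
  unfolding H_eq using card_image[OF edge_inj] by simp

sublocale simple_graph H
proof
  show "finite H" by (simp add: H_def)
  show "card e = 2" if "e \<in> H" for e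
    using that ends_neq by (auto simp: H_eq)
qed

lemma V_H: "V H = a ` {..<m} \<union> b ` {..<m}"
  by (auto simp: V_def H_eq)

lemma ends_in_V: "i < m \<Longrightarrow> a i \<in> V H" "i < m \<Longrightarrow> b i \<in> V H"
  by (auto simp: V_H)

lemma card_V_H: "card (V H) \<le> 2 * m"
proof -
  have "card (V H) \<le> card (a ` {..<m}) + card (b ` {..<m})"
    unfolding V_H by (rule card_Un_le)
  also have "\<dots> \<le> 2 * m"
    using card_image_le[of "{..<m}" a] card_image_le[of "{..<m}" b] by simp
  finally show ?thesis .
qed

lemma N_large: "card (V H) ^ 3 < N"
  using power_mono[OF card_V_H, of 3] by (simp add: N_def power_mult_distrib)

definition stuck :: "(nat \<Rightarrow> nat) \<Rightarrow> (nat \<Rightarrow> nat) \<Rightarrow> (nat \<Rightarrow> nat) \<Rightarrow> nat \<Rightarrow> bool" where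
  "stuck l x y i \<longleftrightarrow> (0 < x i \<longrightarrow> l (a i) \<le> l (b i) + 1) \<and> (0 < y i \<longrightarrow> l (b i) \<le> l (a i) + 1)"

text \<open>Translation from edge numbers to edges: the listed edges are distinct as sets, so the
  number of an edge can be recovered from it and the token arrays define a function on
  \<open>H\<close>.\<close>

lemma balanced_tokens_weight:
  assumes sum: "\<And>i. i < m \<Longrightarrow> x i + y i = N" and stuck: "\<And>i. i < m \<Longrightarrow> stuck (weight m a b x y) x y i"
  shows "\<exists>X. balanced_tokens H N X (weight m a b x y)"
proof -
  define ix where "ix = the_inv_into {..<m} (\<lambda>i. {a i, b i})"
  have ix: "ix {a i, b i} = i" if "i < m" for i
    unfolding ix_def using the_inv_into_f_f[OF edge_inj, of i] that by simp
  define X where "X = (\<lambda>e w. (if a (ix e) = w then x (ix e) else 0) + (if b (ix e) = w then y (ix e) else 0))"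
  have X: "X {a i, b i} w = (if a i = w then x i else 0) + (if b i = w then y i else 0)" if "i < m" for i w
    by (simp only: X_def ix[OF that])
  have "balanced_tokens H N X (weight m a b x y)"
  proof
    show "card (V H) ^ 3 < N" by (rule N_large)
    show "(\<Sum>v\<in>e. X e v) = N" if "e \<in> H" for e
    proof -
      obtain i where "i < m" "e = {a i, b i}" using \<open>e \<in> H\<close> by (auto simp: H_eq)
      then show ?thesis using ends_neq[of i] sum[of i] X[of i] by simp
    qed
    show "weight m a b x y v = (\<Sum>e\<in>{e \<in> H. v \<in> e}. X e v)" for v
    proof -
      have "(\<Sum>e\<in>{e \<in> H. v \<in> e}. X e v) = (\<Sum>e\<in>H. X e v)"
      proof (rule sum.mono_neutral_left)
        show "\<forall>e\<in>H - {e \<in> H. v \<in> e}. X e v = 0"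
          using X by (auto simp: H_eq split: if_splits)
      qed (use finite_H in auto)
      also have "\<dots> = (\<Sum>i<m. X {a i, b i} v)"
        unfolding H_eq by (subst sum.reindex[OF edge_inj]) simp
      also have "\<dots> = weight m a b x y v"
        unfolding weight_def using X by (intro sum.cong) auto
      finally show ?thesis by simp
    qed
    show "weight m a b x y u \<le> weight m a b x y v + 1"
      if "e \<in> H" "u \<in> e" "v \<in> e" "0 < X e u" for e u v
    proof -
      obtain i where i: "i < m" "e = {a i, b i}" using \<open>e \<in> H\<close> by (auto simp: H_eq)
      show ?thesis
        using that i X[OF i(1)] stuck[OF i(1)] ends_neq[OF i(1)] by (auto simp: stuck_def)
    qed
  qed
  then show ?thesis by blast
qed

text \<open>All edges before the search position are stuck, so the position \<open>m\<close>
  certifies that no move is left. The two untouched zero arrays are carried along for the later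
  phases.\<close>

definition balancing :: "state \<Rightarrow> bool" where
  "balancing s \<longleftrightarrow> arr s a_in = A \<and> var s v_edges = m \<and> var s v_R = N * m + 2 \<and>
    arr s a_present = (\<lambda>_. 0) \<and> arr s a_seen = (\<lambda>_. 0) \<and>
    (\<forall>i<m. arr s a_fst i + arr s a_snd i = N) \<and>
    arr s a_load = weight m a b (arr s a_fst) (arr s a_snd) \<and>
    var s v_i \<le> m \<and> (\<forall>i < var s v_i. stuck (arr s a_load) (arr s a_fst) (arr s a_snd) i)"

text \<open>Lexicographic: a move restarts the search for a movable token at the first edge.\<close>

definition potential :: "state \<Rightarrow> nat" where
  "potential s = (\<Sum>v\<in>V H. (arr s a_load v)\<^sup>2) * (m + 1) + (m - var s v_i)"

text \<open>The interface between balancing and scanning, in which the token arrays occur only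
  through an existential statement.\<close>

definition prepared :: "state \<Rightarrow> bool" where
  "prepared s \<longleftrightarrow> arr s a_in = A \<and> var s v_edges = m \<and> var s v_R = N * m + 2 \<and>
    (\<forall>x. 0 < arr s a_present x \<longleftrightarrow> (\<exists>w\<in>V H. arr s a_load w = x)) \<and>
    arr s a_seen = (\<lambda>_. 0) \<and> (\<forall>w. arr s a_load w + 1 < N * m + 2) \<and>
    (\<exists>X. balanced_tokens H N X (arr s a_load))"

text \<open>The factor \<open>m + 1\<close> makes a loss of one in the sum of squares outweigh the
  at most \<open>m\<close> regained by resetting the search position.\<close>

lemma potential_move:
  assumes "u \<in> V H" "w \<in> V H" "arr s a_load w + 1 < arr s a_load u"
    "arr s' a_load = (arr s a_load)(u := arr s a_load u - 1, w := arr s a_load w + 1)" "var s' v_i = 0"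
  shows "potential s' < potential s"
proof -
  have "(\<Sum>v\<in>V H. (arr s' a_load v)\<^sup>2) + 1 \<le> (\<Sum>v\<in>V H. (arr s a_load v)\<^sup>2)"
    using sum_squares_move[OF finite_V[OF order_refl] assms(1-3)] assms(4) by simp
  then have "((\<Sum>v\<in>V H. (arr s' a_load v)\<^sup>2) + 1) * (m + 1) \<le> (\<Sum>v\<in>V H. (arr s a_load v)\<^sup>2) * (m + 1)"
    by (rule mult_le_mono1)
  then show ?thesis using assms(5) unfolding potential_def by simp
qed

lemma runs_square:
  assumes "arr s = arr (init_state input)" "var s v_edges = m" "var s v_i = 0" "var s v_square = 0" "var s v_N = 0"
  shows "runs (While more_edges square_body) s
    (m * (1 + bcost more_edges + max_cost square_body) + (1 + bcost more_edges))
    (\<lambda>s. arr s = arr (init_state input) \<and> var s v_edges = m \<and> var s v_i = m \<and> var s v_square = m * m \<and> var s v_N = 0)"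
proof (rule runs_For[where I = "\<lambda>k s. arr s = arr (init_state input) \<and> var s v_edges = m \<and> var s v_i = k \<and>
    var s v_square = k * m \<and> var s v_N = 0"])
  fix k and s :: state assume "k < m" "arr s = arr (init_state input) \<and> var s v_edges = m \<and> var s v_i = k \<and>
    var s v_square = k * m \<and> var s v_N = 0"
  then show "runs square_body s (max_cost square_body)
    (\<lambda>s. arr s = arr (init_state input) \<and> var s v_edges = m \<and> var s v_i = Suc k \<and>
    var s v_square = Suc k * m \<and> var s v_N = 0)"
    by (intro runs_loop_free) (auto simp: square_body_def)
qed (use assms in auto)

lemma runs_cube:
  assumes "arr s = arr (init_state input)" "var s v_edges = m" "var s v_i = 0" "var s v_square = m * m" "var s v_N = 0"
  shows "runs (While more_edges cube_body) s
    (m * (1 + bcost more_edges + max_cost cube_body) + (1 + bcost more_edges))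
    (\<lambda>s. arr s = arr (init_state input) \<and> var s v_edges = m \<and> var s v_i = m \<and> var s v_square = m * m \<and>
      var s v_N = m * (8 * (m * m)))"
proof (rule runs_For[where I = "\<lambda>k s. arr s = arr (init_state input) \<and> var s v_edges = m \<and> var s v_i = k \<and>
    var s v_square = m * m \<and> var s v_N = k * (8 * (m * m))"])
  fix k and s :: state assume "k < m" "arr s = arr (init_state input) \<and> var s v_edges = m \<and> var s v_i = k \<and>
    var s v_square = m * m \<and> var s v_N = k * (8 * (m * m))"
  then show "runs cube_body s (max_cost cube_body)
    (\<lambda>s. arr s = arr (init_state input) \<and> var s v_edges = m \<and> var s v_i = Suc k \<and>
    var s v_square = m * m \<and> var s v_N = Suc k * (8 * (m * m)))"
    by (intro runs_loop_free) (auto simp: cube_body_def)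
qed (use assms in auto)

definition filled :: "nat \<Rightarrow> state \<Rightarrow> bool" where
  "filled k s \<longleftrightarrow> arr s a_in = A \<and> var s v_edges = m \<and> var s v_i = k \<and> var s v_N = N \<and>
    var s v_R = N * k + 2 \<and> arr s a_snd = (\<lambda>_. 0) \<and>
    arr s a_present = (\<lambda>_. 0) \<and> arr s a_seen = (\<lambda>_. 0) \<and>
    arr s a_fst = (\<lambda>i. if i < k then N else 0) \<and>
    arr s a_load = (\<lambda>w. \<Sum>i<k. if a i = w then N else 0)"

lemma runs_fill:
  assumes "filled 0 s"
  shows "runs (While more_edges fill_body) s
    (m * (1 + bcost more_edges + max_cost fill_body) + (1 + bcost more_edges)) (filled m)"
proof (rule runs_For)
  fix k and s :: state assume "k < m" "filled k s"
  then show "runs fill_body s (max_cost fill_body) (filled (Suc k))"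
    by (intro runs_loop_free) (auto simp: fill_body_def filled_def A_simps fun_eq_iff)
qed (use assms in \<open>auto simp: filled_def\<close>)

lemma filled_balancing:
  assumes "filled m s" "s' = effect (Assign v_i (Const 0)) s"
  shows "balancing s' \<and> potential s' \<le> 2 * m * (N * m)\<^sup>2 * (m + 1) + m"
proof -
  have "arr s a_load = weight m a b (arr s a_fst) (arr s a_snd)"
    using assms(1) by (auto simp: filled_def weight_def fun_eq_iff intro!: sum.cong)
  then have bal: "balancing s'" using assms by (auto simp: balancing_def filled_def)
  have "arr s' a_load w \<le> N * m" for w
    using bal ends_neq weight_le[of m "arr s' a_fst" "arr s' a_snd" N a b] by (auto simp: balancing_def)
  then have "(\<Sum>v\<in>V H. (arr s' a_load v)\<^sup>2) \<le> card (V H) * (N * m)\<^sup>2"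
    using sum_bounded_above[of "V H" "\<lambda>v. (arr s' a_load v)\<^sup>2" "(N * m)\<^sup>2"] by (simp add: power_mono)
  also have "\<dots> \<le> 2 * m * (N * m)\<^sup>2" using card_V_H by (rule mult_le_mono1)
  finally have "(\<Sum>v\<in>V H. (arr s' a_load v)\<^sup>2) * (m + 1) \<le> 2 * m * (N * m)\<^sup>2 * (m + 1)"
    by (rule mult_le_mono1)
  then show ?thesis using bal unfolding potential_def by (simp add: add_le_mono)
qed

lemma balance_body_step:
  assumes s: "balancing s" "var s v_i < m" and s': "s' = effect balance_body s"
  shows "balancing s' \<and> potential s' < potential s"
proof -
  define i where "i = var s v_i"
  define l where "l = arr s a_load"
  have i: "i < m" and A: "arr s a_in = A" "A (Suc (i + i)) = a i" "A (Suc (Suc (i + i))) = b i" "a i \<noteq> b i" "b i \<noteq> a i"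
    using s A_simps ends_neq[of i] by (auto simp: i_def balancing_def)
  have bal: "l = weight m a b (arr s a_fst) (arr s a_snd)" "arr s a_fst i + arr s a_snd i = N"
    using s i by (auto simp: balancing_def l_def)
  \<comment> \<open>These are the three branches of the program; in the last one edge
    \<open>i\<close> is stuck and the search advances.\<close>
  consider (1) "l (b i) + 1 < l (a i)" "0 < arr s a_fst i"
    | (2) "\<not> (l (b i) + 1 < l (a i) \<and> 0 < arr s a_fst i)" "l (a i) + 1 < l (b i)" "0 < arr s a_snd i"
    | (3) "\<not> (l (b i) + 1 < l (a i) \<and> 0 < arr s a_fst i)" "\<not> (l (a i) + 1 < l (b i) \<and> 0 < arr s a_snd i)"
    by metis
  then show ?thesis
  proof cases
    case 1
    have s'_eq: "var s' = (var s)(v_i := 0)"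
      "arr s' = (arr s)(a_fst := (arr s a_fst)(i := arr s a_fst i - 1), a_snd := (arr s a_snd)(i := arr s a_snd i + 1),
        a_load := l(a i := l (a i) - 1, b i := l (b i) + 1))"
      using 1 A unfolding s' by (auto simp: balance_body_def movable_def move_def i_def[symmetric] l_def fun_eq_iff)
    have "l(a i := l (a i) - 1, b i := l (b i) + 1) =
      weight m a b ((arr s a_fst)(i := arr s a_fst i - 1)) ((arr s a_snd)(i := arr s a_snd i + 1))"
      unfolding bal(1) by (rule weight_move[symmetric]) (use i A 1 in auto)
    then have "balancing s'" using s(1) 1 bal(2) unfolding balancing_def s'_eq by auto
    moreover have "potential s' < potential s"
      using ends_in_V[OF i] 1 by (intro potential_move[of "a i" "b i"]) (auto simp: s'_eq l_def)
    ultimately show ?thesis by simp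
  next
    case 2
    have s'_eq: "var s' = (var s)(v_i := 0)"
      "arr s' = (arr s)(a_snd := (arr s a_snd)(i := arr s a_snd i - 1), a_fst := (arr s a_fst)(i := arr s a_fst i + 1),
        a_load := l(b i := l (b i) - 1, a i := l (a i) + 1))"
      using 2 A unfolding s' by (auto simp: balance_body_def movable_def move_def i_def[symmetric] l_def fun_eq_iff)
    \<comment> \<open>The previous case with the two ends of every edge exchanged, which
      \<open>weight_swap\<close> permits.\<close>
    have "l(b i := l (b i) - 1, a i := l (a i) + 1) =
      weight m b a ((arr s a_snd)(i := arr s a_snd i - 1)) ((arr s a_fst)(i := arr s a_fst i + 1))"
      unfolding bal(1) weight_swap[of m a] by (rule weight_move[symmetric]) (use i A 2 in auto)
    then have "balancing s'" using s(1) 2 bal(2) unfolding balancing_def s'_eq weight_swap[of m a] by auto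
    moreover have "potential s' < potential s"
      using ends_in_V[OF i] 2 by (intro potential_move[of "b i" "a i"]) (auto simp: s'_eq l_def)
    ultimately show ?thesis by simp
  next
    case 3
    have s'_eq: "var s' = (var s)(v_i := Suc i)" "arr s' = arr s"
      using 3 A unfolding s' by (auto simp: balance_body_def movable_def i_def[symmetric] l_def)
    have "stuck l (arr s a_fst) (arr s a_snd) i" using 3 by (auto simp: stuck_def)
    then show ?thesis
      using s i unfolding balancing_def potential_def s'_eq
      by (auto simp: l_def i_def[symmetric] less_Suc_eq)
  qed
qed

lemma runs_balance:
  assumes "balancing s" "potential s \<le> balance_loop_bound m"
  shows "runs (While more_edges balance_body) s
    (balance_loop_bound m * (1 + bcost more_edges + max_cost balance_body) + (1 + bcost more_edges))
    (\<lambda>s. balancing s \<and> var s v_i = m)"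
proof (rule runs_mono)
  show "runs (While more_edges balance_body) s
    (potential s * (1 + bcost more_edges + max_cost balance_body) + (1 + bcost more_edges))
    (\<lambda>s. balancing s \<and> \<not> bval more_edges s)"
  proof (rule runs_While[where I = balancing and f = potential])
    fix s :: state assume "balancing s" "bval more_edges s"
    then have "balancing (effect balance_body s) \<and> potential (effect balance_body s) < potential s"
      by (intro balance_body_step) (auto simp: balancing_def)
    then show "runs balance_body s (max_cost balance_body) (\<lambda>s'. balancing s' \<and> potential s' < potential s)"
      by (intro runs_loop_free) (auto simp: balance_body_def move_def)
  qed (rule assms)
  show "potential s * (1 + bcost more_edges + max_cost balance_body) + (1 + bcost more_edges)
    \<le> balance_loop_bound m * (1 + bcost more_edges + max_cost balance_body) + (1 + bcost more_edges)"
    by (intro add_mono mult_le_mono1 assms order_refl)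
qed (auto simp: balancing_def)

definition marked :: "(nat \<Rightarrow> nat) \<Rightarrow> nat \<Rightarrow> state \<Rightarrow> bool" where
  "marked l k s \<longleftrightarrow> arr s a_in = A \<and> var s v_edges = m \<and> var s v_R = N * m + 2 \<and>
    var s v_i = k \<and> arr s a_seen = (\<lambda>_. 0) \<and> arr s a_load = l \<and>
    (\<forall>x. 0 < arr s a_present x \<longleftrightarrow> (\<exists>i<k. l (a i) = x \<or> l (b i) = x))"

lemma runs_mark:
  assumes "marked l 0 s"
  shows "runs (While more_edges mark_body) s
    (m * (1 + bcost more_edges + max_cost mark_body) + (1 + bcost more_edges)) (marked l m)"
proof (rule runs_For)
  fix k and s :: state assume "k < m" "marked l k s"
  then show "runs mark_body s (max_cost mark_body) (marked l (Suc k))"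
    by (intro runs_loop_free) (auto simp: mark_body_def marked_def A_simps less_Suc_eq)
qed (use assms in \<open>auto simp: marked_def\<close>)

lemma marked_prepared:
  assumes "balancing s" "var s v_i = m" "marked (arr s a_load) m s'"
  shows "prepared s'"
proof -
  define x where "x = arr s a_fst"
  define y where "y = arr s a_snd"
  have l: "arr s' a_load = weight m a b x y" "arr s a_load = weight m a b x y" and xy: "\<And>i. i < m \<Longrightarrow> x i + y i = N"
    and st: "\<And>i. i < m \<Longrightarrow> stuck (weight m a b x y) x y i"
    using assms unfolding balancing_def marked_def x_def y_def by (metis, metis, metis, metis)
  have "arr s' a_load w \<le> N * m" for w
    unfolding l using weight_le[OF xy ends_neq] by simp
  \<comment> \<open>Every vertex of \<open>V H\<close> is an endpoint of a listed edge, so marking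
    edge by edge reaches all occurring loads.\<close>
  moreover have "(\<exists>i<m. weight m a b x y (a i) = z \<or> weight m a b x y (b i) = z) \<longleftrightarrow>
     (\<exists>w\<in>V H. weight m a b x y w = z)" for z
    unfolding V_H by auto
  ultimately show ?thesis
    using assms(3) balanced_tokens_weight[OF xy st] unfolding prepared_def marked_def l
    by (auto simp: less_Suc_eq_le)
qed

lemma runs_balance_prog: "runs balance_prog (init_state input) (balance_time m) prepared"
  unfolding balance_prog_def balance_time_def
proof (rule runs_Seq[OF runs_effect], simp, goal_cases)
  case prems: (1 s)
  have "arr (init_state input) 0 0 = m" using A_simps(1) by (simp add: A_def)
  then have 1: "arr s = arr (init_state input)" "var s v_edges = m" "var s v_i = 0" "var s v_square = 0" "var s v_N = 0"
    unfolding prems by (auto simp: init_state_def)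
  show ?case
  proof (rule runs_Seq[OF runs_square[OF 1]], rule runs_Seq[OF runs_effect], simp,
      rule runs_Seq[OF runs_cube], goal_cases)
    case (6 s1 s2 s3)
    show ?case
    proof (rule runs_Seq[OF runs_effect], simp, rule runs_Seq[OF runs_fill], goal_cases)
      case (1 s4)
      then show ?case
        using 6 by (auto simp: filled_def N_def A_def init_state_def power3_eq_cube mult_ac fun_eq_iff)
    next
      case (2 s4 s5)
      show ?case
      proof (rule runs_Seq[OF runs_effect], simp, rule runs_Seq[OF runs_balance], goal_cases)
        case (1 s6)
        then show ?case using filled_balancing[OF 2(2)] by simp
      next
        case (2 s6)
        then show ?case using filled_balancing[OF \<open>filled m s5\<close>] by (simp add: balance_loop_bound_def N_def)
      next
        case (3 s6 s7)
        show ?case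
        proof (rule runs_Seq[OF runs_effect], simp, goal_cases)
          case (1 s8)
          have "marked (arr s7 a_load) 0 s8"
            using 3 1 by (auto simp: marked_def balancing_def)
          then show ?case
            by (rule runs_mono[OF runs_mark order_refl]) (use 3 marked_prepared in blast)
        qed
      qed
    qed
  qed auto
qed

end

section \<open>Scanning the load thresholds\<close>

abbreviation (input) "v_count \<equiv> 9 :: nat"
abbreviation (input) "v_items \<equiv> 10 :: nat"
abbreviation (input) "v_pos \<equiv> 11 :: nat"
abbreviation (input) "v_seen \<equiv> 12 :: nat"
abbreviation (input) "v_prev_count \<equiv> 13 :: nat"
abbreviation (input) "v_prev_seen \<equiv> 14 :: nat"

abbreviation (input) "more_thresholds \<equiv> Less (Var v_j) (Var v_R)"

definition at_threshold :: bexp where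
  "at_threshold = BAnd (Less (Const 0) (Cell a_present (Var v_r)))
     (BNot (Less (Const 0) (Cell a_present (Minus (Var v_r) (Const 1)))))"

text \<open>As \<open>v_j\<close> runs from 0 to \<open>R - 1\<close>, \<open>v_r\<close> runs from
  \<open>R\<close> down to 1, the order used in \<open>thresholds R\<close>. The command
  \<open>emit\<close> is the only difference between the scans of the two programs.\<close>

definition scan_body :: "com \<Rightarrow> com" where
  "scan_body emit = Seq (Assign v_r (Minus (Var v_R) (Var v_j)))
     (Seq (Cond at_threshold emit Skip) (inc v_j))"

definition in_level :: bexp where
  "in_level = BAnd (BNot (Less (Cell a_load first_end) (Var v_r)))
     (BNot (Less (Cell a_load second_end) (Var v_r)))"

definition copy_edge :: com where
  "copy_edge = Seq
     (Cond in_level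
       (block [Store a_out (Var v_out_len) first_end,
          Store a_out (Plus (Var v_out_len) (Const 1)) second_end,
          Assign v_out_len (Plus (Var v_out_len) (Const 2)), inc v_count])
       Skip)
     (inc v_i)"

text \<open>One cell is reserved for the number of edges, which is known only after the copying and
  is filled in by \<open>end_graph\<close>.\<close>

definition begin_graph :: com where
  "begin_graph = block [Assign v_pos (Var v_out_len), inc v_out_len, Assign v_count (Const 0), Assign v_i (Const 0)]"

definition end_graph :: com where
  "end_graph = block [Store a_out (Var v_pos) (Var v_count), inc v_items]"

definition emit_graph :: com where
  "emit_graph = Seq begin_graph (Seq (While more_edges copy_edge) end_graph)"

text \<open>The marks and the counter survive from one threshold to the next. As the levels grow,
  the increase of \<open>v_seen\<close> is the number of vertices new in the current layer.\<close>

definition see :: "aexp \<Rightarrow> com" where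
  "see u = Cond (Less (Const 0) (Cell a_seen u)) Skip (block [Store a_seen u (Const 1), inc v_seen])"

definition count_edge :: com where
  "count_edge = Seq (Cond in_level (block [inc v_count, see first_end, see second_end]) Skip) (inc v_i)"

definition begin_interval :: com where
  "begin_interval = block [Assign v_count (Const 0), Assign v_i (Const 0)]"

definition end_interval :: com where
  "end_interval = block
     [Store a_out (Var v_out_len) (Var v_prev_count),
      Store a_out (Plus (Var v_out_len) (Const 1)) (Var v_edges),
      Store a_out (Plus (Var v_out_len) (Const 2)) (Minus (Var v_seen) (Var v_prev_seen)),
      Store a_out (Plus (Var v_out_len) (Const 3)) (Minus (Var v_count) (Var v_prev_count)),
      Assign v_out_len (Plus (Var v_out_len) (Const 4)),
      Assign v_prev_count (Var v_count), Assign v_prev_seen (Var v_seen), inc v_items]"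

definition emit_interval :: com where
  "emit_interval = Seq begin_interval (Seq (While more_edges count_edge) end_interval)"

text \<open>Cell 0 stays free for the number of graphs; the 0 in cell 1 is the complete code of the
  initial empty graph.\<close>

definition begin_onion :: com where
  "begin_onion = block [Assign v_out_len (Const 2), Store a_out (Const 1) (Const 0),
     Assign v_items (Const 1), Assign v_j (Const 0)]"

definition begin_phi :: com where
  "begin_phi = block [Assign v_out_len (Const 1), Assign v_items (Const 0), Assign v_prev_count (Const 0),
     Assign v_seen (Const 0), Assign v_prev_seen (Const 0), Assign v_j (Const 0)]"

definition full_prog :: "com \<Rightarrow> com \<Rightarrow> com" where
  "full_prog init emit = Seq balance_prog
     (Seq init (Seq (While more_thresholds (scan_body emit)) (Store a_out (Const 0) (Var v_items))))"

definition segment :: "(nat \<Rightarrow> nat) \<Rightarrow> nat \<Rightarrow> nat \<Rightarrow> nat list" where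
  "segment f i j = map f [i..<j]"

lemma segment_Suc: "i \<le> j \<Longrightarrow> segment f i (Suc j) = segment f i j @ [f j]"
  by (simp add: segment_def)

lemma segment_upd: "k < i \<or> j \<le> k \<Longrightarrow> segment (f(k := x)) i j = segment f i j"
  by (auto simp: segment_def)

lemma segment_split: "i \<le> p \<Longrightarrow> p < j \<Longrightarrow> segment f i j = segment f i p @ f p # segment f (Suc p) j"
proof -
  assume "i \<le> p" "p < j"
  then have "[i..<j] = [i..<p] @ p # [Suc p..<j]"
    by (metis le_add_diff_inverse less_imp_le_nat upt_add_eq_append upt_conv_Cons)
  then show ?thesis by (simp add: segment_def)
qed

lemma segment_empty: "segment f i i = []"
  by (simp add: segment_def)

definition emit_graph_time :: "nat \<Rightarrow> nat" where
  "emit_graph_time k = max_cost begin_graph +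
     ((k * (1 + bcost more_edges + max_cost copy_edge) + (1 + bcost more_edges)) + max_cost end_graph)"

definition emit_interval_time :: "nat \<Rightarrow> nat" where
  "emit_interval_time k = max_cost begin_interval +
     ((k * (1 + bcost more_edges + max_cost count_edge) + (1 + bcost more_edges)) + max_cost end_interval)"

locale balanced_edge_list =
  edge_list es + balanced_tokens "edge_list.H es" "edge_list.N es" X load
  for es :: "(nat \<times> nat) list" and X :: "nat set \<Rightarrow> nat \<Rightarrow> nat" and load :: "nat \<Rightarrow> nat" +
  assumes load_bound: "load w + 1 < N * m + 2"
begin

definition R :: nat where "R = N * m + 2"

definition frame :: "state \<Rightarrow> bool" where
  "frame s \<longleftrightarrow> arr s a_in = A \<and> var s v_edges = m \<and> var s v_R = R \<and> arr s a_load = load \<and>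
    (\<forall>x. 0 < arr s a_present x \<longleftrightarrow> present x)"

lemma rev_upt_R: "rev [1..<Suc R] = map (\<lambda>j. R - j) [0..<R]"
  by (rule nth_equalityI) (auto simp: rev_nth simp del: upt_Suc)

text \<open>\<open>E rs\<close> describes the output after the thresholds \<open>rs\<close>. The
  emitter may rely on a new threshold lying below all earlier ones, which makes the levels
  nested.\<close>

lemma runs_scan:
  assumes E_var: "\<And>rs s x v. x \<in> {v_j, v_r} \<Longrightarrow> E rs s \<Longrightarrow> E rs (s\<lparr>var := (var s)(x := v)\<rparr>)"
    and emit: "\<And>rs r s. frame s \<Longrightarrow> var s v_r = r \<Longrightarrow> E rs s \<Longrightarrow> \<forall>x\<in>set (R # rs). r < x \<Longrightarrow>
      runs emit s T (\<lambda>s'. frame s' \<and> var s' v_j = var s v_j \<and> E (rs @ [r]) s')"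
    and T: "1 \<le> T"
    and s: "frame s" "var s v_j = 0" "E [] s"
  shows "runs (While more_thresholds (scan_body emit)) s
    (R * (1 + bcost more_thresholds + (max_cost (Assign v_r (Minus (Var v_R) (Var v_j))) +
       ((1 + bcost at_threshold + T) + max_cost (inc v_j)))) + (1 + bcost more_thresholds))
    (E (thresholds R))"
proof -
  let ?P = "\<lambda>r. present r \<and> \<not> present (r - 1)"
  let ?rs = "\<lambda>k. filter ?P (map (\<lambda>j. R - j) [0..<k])"
  let ?I = "\<lambda>k s. frame s \<and> var s v_j = k \<and> E (?rs k) s"
  have step: "runs (scan_body emit) s (max_cost (Assign v_r (Minus (Var v_R) (Var v_j))) +
       ((1 + bcost at_threshold + T) + max_cost (inc v_j))) (?I (Suc k))"
    if k: "k < R" and I: "?I k s" for k and s :: state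
    unfolding scan_body_def
  proof (rule runs_Seq[OF runs_effect], simp)
    fix s1 assume s1: "s1 = effect (Assign v_r (Minus (Var v_R) (Var v_j))) s"
    define r where "r = R - k"
    have I1: "frame s1" "var s1 v_j = k" "var s1 v_r = r" "E (?rs k) s1"
      using I unfolding s1 by (auto simp: frame_def r_def intro!: E_var)
    have P: "bval at_threshold s1 \<longleftrightarrow> ?P r"
      using I1 by (auto simp: at_threshold_def frame_def)
    have rs: "?rs (Suc k) = ?rs k @ (if ?P r then [r] else [])"
      by (simp add: r_def)
    \<comment> \<open>The first value tested is \<open>R\<close> itself; it does not occur as a
      load, so everything emitted lies strictly below \<open>R\<close>.\<close>
    have "load v \<noteq> R" for v using load_bound[of v] by (simp add: R_def)
    then have "\<not> present R" by (simp add: present_def)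
    then have lt: "\<forall>x\<in>set (R # ?rs k). r < x" if "?P r"
      using that k unfolding r_def by (cases "k = 0") auto
    show "runs (Seq (Cond at_threshold emit Skip) (inc v_j)) s1
        (1 + bcost at_threshold + T + max_cost (inc v_j)) (?I (Suc k))"
    proof (rule runs_Seq)
      show "runs (Cond at_threshold emit Skip) s1 (1 + bcost at_threshold + T)
        (\<lambda>s'. frame s' \<and> var s' v_j = k \<and> E (?rs (Suc k)) s')"
      proof (rule runs_Cond)
        assume b: "bval at_threshold s1"
        show "runs emit s1 T (\<lambda>s'. frame s' \<and> var s' v_j = k \<and> E (?rs (Suc k)) s')"
          using emit[OF I1(1,3,4) lt] b I1(2) rs P by simp
      next
        assume b: "\<not> bval at_threshold s1"
        show "runs Skip s1 T (\<lambda>s'. frame s' \<and> var s' v_j = k \<and> E (?rs (Suc k)) s')"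
          using runs_effect[of Skip s1] by (rule runs_mono) (use T b I1 rs P in auto)
      qed
    next
      fix s2 assume s2: "frame s2 \<and> var s2 v_j = k \<and> E (?rs (Suc k)) s2"
      then have "?I (Suc k) (effect (inc v_j) s2)"
        by (auto simp: frame_def intro!: E_var)
      then show "runs (inc v_j) s2 (max_cost (inc v_j)) (?I (Suc k))"
        by (intro runs_loop_free) auto
    qed
  qed
  have "runs (While more_thresholds (scan_body emit)) s
    (R * (1 + bcost more_thresholds + (max_cost (Assign v_r (Minus (Var v_R) (Var v_j))) +
       ((1 + bcost at_threshold + T) + max_cost (inc v_j)))) + (1 + bcost more_thresholds)) (?I R)"
    by (rule runs_For[where I = ?I]) (use step s in \<open>auto simp: frame_def\<close>)
  moreover have "thresholds R = ?rs R" by (simp only: thresholds_def rev_upt_R)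
  ultimately show ?thesis by (auto elim: runs_mono)
qed

definition selected :: "nat \<Rightarrow> nat \<Rightarrow> (nat \<times> nat) list" where
  "selected r k = filter (\<lambda>(u, v). r \<le> load u \<and> r \<le> load v) (take k es)"

lemma selected_0: "selected r 0 = []"
  by (simp add: selected_def)

lemma selected_Suc:
  "k < m \<Longrightarrow> selected r (Suc k) =
    selected r k @ (if r \<le> load (a k) \<and> r \<le> load (b k) then [(a k, b k)] else [])"
  by (auto simp: selected_def take_Suc_conv_app_nth m_def a_def b_def)

lemma level_selected: "level r = set (map (\<lambda>(u, v). {u, v}) (selected r m))"
proof -
  have "level r = {e \<in> H. \<forall>v\<in>e. r \<le> load v}" by (simp add: level_def)
  then show ?thesis unfolding H_def selected_def m_def by auto
qed

lemma distinct_selected: "distinct (map (\<lambda>(u, v). {u, v}) (selected r m))"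
  unfolding selected_def m_def using distinct_edges by (simp add: distinct_map_filter)

lemma card_level: "card (level r) = length (selected r m)"
  unfolding level_selected using distinct_card[OF distinct_selected] by simp

definition code :: "nat \<Rightarrow> nat list" where
  "code r = length (selected r m) # concat (map (\<lambda>(u, v). [u, v]) (selected r m))"

lemma graph_code_level: "graph_code (level r) (code r)"
  unfolding graph_code_def code_def using level_selected distinct_selected by blast

definition graphs_written :: "nat list \<Rightarrow> state \<Rightarrow> bool" where
  "graphs_written rs s \<longleftrightarrow> var s v_items = Suc (length rs) \<and> 0 < var s v_out_len \<and>
    segment (arr s a_out) 1 (var s v_out_len) = 0 # concat (map code rs)"

definition copied :: "nat \<Rightarrow> nat \<Rightarrow> nat \<Rightarrow> nat \<Rightarrow> nat list \<Rightarrow> nat \<Rightarrow> state \<Rightarrow> bool" where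
  "copied r j K p old k s \<longleftrightarrow> frame s \<and> var s v_r = r \<and> var s v_j = j \<and> var s v_items = K \<and>
    var s v_i = k \<and> var s v_pos = p \<and> 0 < p \<and> p < var s v_out_len \<and>
    segment (arr s a_out) 1 p = old \<and>
    segment (arr s a_out) (Suc p) (var s v_out_len) = concat (map (\<lambda>(u, v). [u, v]) (selected r k)) \<and>
    var s v_count = length (selected r k)"

lemma runs_emit_graph:
  assumes "frame s" "var s v_r = r" "graphs_written rs s"
  shows "runs emit_graph s (emit_graph_time m)
    (\<lambda>s'. frame s' \<and> var s' v_j = var s v_j \<and> graphs_written (rs @ [r]) s')"
  unfolding emit_graph_def emit_graph_time_def
proof (rule runs_Seq[OF runs_effect], simp add: begin_graph_def)
  define p where "p = var s v_out_len"
  define old where "old = segment (arr s a_out) 1 p"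
  let ?I = "copied r (var s v_j) (var s v_items) p old"
  fix s1 assume s1: "s1 = effect begin_graph s"
  show "runs (Seq (While more_edges copy_edge) end_graph) s1
    ((m * (1 + bcost more_edges + max_cost copy_edge) + (1 + bcost more_edges)) + max_cost end_graph)
    (\<lambda>s'. frame s' \<and> var s' v_j = var s v_j \<and> graphs_written (rs @ [r]) s')"
  proof (rule runs_Seq)
    show "runs (While more_edges copy_edge) s1
      (m * (1 + bcost more_edges + max_cost copy_edge) + (1 + bcost more_edges)) (?I m)"
    proof (rule runs_For)
      fix k and s' :: state assume k: "k < m" and I: "?I k s'"
      have "?I (Suc k) (effect copy_edge s')"
        using I k selected_Suc[OF k, of r]
        by (auto simp: copied_def copy_edge_def in_level_def frame_def A_simps segment_Suc segment_upd)
      then show "runs copy_edge s' (max_cost copy_edge) (?I (Suc k))"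
        by (intro runs_loop_free) (auto simp: copy_edge_def)
    next
      show "?I 0 s1"
        using assms unfolding s1 graphs_written_def
        by (auto simp: copied_def begin_graph_def frame_def p_def old_def selected_0 segment_empty)
    qed (auto simp: copied_def frame_def)
  next
    fix s2 assume I: "?I m s2"
    \<comment> \<open>Splitting at the reserved cell \<open>p\<close> shows that filling in the
      header leaves the earlier graphs and the copied edges intact.\<close>
    have "segment ((arr s2 a_out)(p := var s2 v_count)) 1 (var s2 v_out_len) =
      old @ code r"
      using I by (subst segment_split[of _ p]) (auto simp: copied_def segment_upd code_def)
    then have "frame (effect end_graph s2) \<and> var (effect end_graph s2) v_j = var s v_j \<and>
      graphs_written (rs @ [r]) (effect end_graph s2)"
      using I assms(3) by (auto simp: copied_def end_graph_def frame_def graphs_written_def old_def p_def)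
    then show "runs end_graph s2 (max_cost end_graph)
      (\<lambda>s'. frame s' \<and> var s' v_j = var s v_j \<and> graphs_written (rs @ [r]) s')"
      by (intro runs_loop_free) (auto simp: end_graph_def)
  qed
qed

definition quad :: "nat list \<Rightarrow> nat \<Rightarrow> nat \<times> nat \<times> nat \<times> nat" where
  "quad rs t = (card (level ((R # rs) ! t)), m,
     card (V (level ((R # rs) ! Suc t)) - V (level ((R # rs) ! t))),
     card (level ((R # rs) ! Suc t) - level ((R # rs) ! t)))"

definition quads :: "nat list \<Rightarrow> (nat \<times> nat \<times> nat \<times> nat) list" where
  "quads rs = map (quad rs) [0..<length rs]"

text \<open>Entry \<open>t\<close> depends only on positions \<open>t\<close> and
  \<open>Suc t\<close> of \<open>R # rs\<close>, so a further threshold leaves the earlier entries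
  unchanged.\<close>

lemma quads_snoc:
  assumes "last (R # rs) = r'"
  shows "quads (rs @ [r]) = quads rs @ [(card (level r'), m, card (V (level r) - V (level r')), card (level r - level r'))]"
proof -
  have "quad (rs @ [r]) t = quad rs t" if "t < length rs" for t
    using that by (cases t) (auto simp: quad_def nth_append)
  moreover have "(R # rs @ [r]) ! length rs = r'"
    using assms by (cases rs rule: rev_cases) (auto simp: nth_append)
  then have "quad (rs @ [r]) (length rs) =
    (card (level r'), m, card (V (level r) - V (level r')), card (level r - level r'))"
    by (simp add: quad_def)
  ultimately show ?thesis by (simp add: quads_def)
qed

definition intervals_written :: "nat list \<Rightarrow> state \<Rightarrow> bool" where
  "intervals_written rs s \<longleftrightarrow> var s v_items = length rs \<and> 0 < var s v_out_len \<and>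
    segment (arr s a_out) 1 (var s v_out_len) = concat (map (\<lambda>(b, d, a, e). [b, d, a, e]) (quads rs)) \<and>
    var s v_prev_count = card (level (last (R # rs))) \<and>
    var s v_prev_seen = card (V (level (last (R # rs)))) \<and> var s v_seen = var s v_prev_seen \<and>
    (\<forall>w. 0 < arr s a_seen w \<longleftrightarrow> w \<in> V (level (last (R # rs))))"

definition ends :: "(nat \<times> nat) list \<Rightarrow> nat set" where
  "ends xs = fst ` set xs \<union> snd ` set xs"

definition counted :: "nat \<Rightarrow> nat set \<Rightarrow> state \<Rightarrow> nat \<Rightarrow> state \<Rightarrow> bool" where
  "counted r W s0 k s \<longleftrightarrow> frame s \<and> var s v_r = r \<and> var s v_j = var s0 v_j \<and> var s v_items = var s0 v_items \<and>
    var s v_i = k \<and> var s v_out_len = var s0 v_out_len \<and> arr s a_out = arr s0 a_out \<and>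
    var s v_prev_count = var s0 v_prev_count \<and> var s v_prev_seen = var s0 v_prev_seen \<and>
    var s v_count = length (selected r k) \<and>
    (\<forall>w. 0 < arr s a_seen w \<longleftrightarrow> w \<in> W \<union> ends (selected r k)) \<and>
    var s v_seen = card (W \<union> ends (selected r k))"

lemma counted_Suc:
  assumes k: "k < m" and I: "counted r W s0 k s" and W: "finite W"
  shows "counted r W s0 (Suc k) (effect count_edge s)"
proof (cases "r \<le> load (a k) \<and> r \<le> load (b k)")
  case False
  then show ?thesis
    using I k selected_Suc[OF k, of r]
    by (auto simp: counted_def count_edge_def in_level_def frame_def A_simps)
next
  case True
  define U where "U = W \<union> ends (selected r k)"
  have fin: "finite U" using W by (simp add: U_def ends_def)
  have sel: "selected r (Suc k) = selected r k @ [(a k, b k)]"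
    using True selected_Suc[OF k] by simp
  have U': "W \<union> ends (selected r (Suc k)) = insert (b k) (insert (a k) U)"
    unfolding U_def sel by (auto simp: ends_def)
  have seen: "\<And>w. 0 < arr s a_seen w \<longleftrightarrow> w \<in> U" "var s v_seen = card U"
    using I by (auto simp: counted_def U_def)
  show ?thesis
    using I k True fin ends_neq[OF k] seen unfolding counted_def U' unfolding sel
    by (auto simp: count_edge_def see_def in_level_def frame_def A_simps card_insert_if)
qed

lemma runs_emit_interval:
  assumes "frame s" "var s v_r = r" "intervals_written rs s" "\<forall>x\<in>set (R # rs). r < x"
  shows "runs emit_interval s (emit_interval_time m)
    (\<lambda>s'. frame s' \<and> var s' v_j = var s v_j \<and> intervals_written (rs @ [r]) s')"
  unfolding emit_interval_def emit_interval_time_def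
proof (rule runs_Seq[OF runs_effect], simp add: begin_interval_def)
  define r' where "r' = last (R # rs)"
  define W where "W = V (level r')"
  let ?I = "counted r W s"
  have "r' \<in> set (R # rs)" unfolding r'_def by (rule last_in_set) simp
  then have "r < r'" using assms(4) by blast
  then have sub: "level r' \<subseteq> level r" by (intro level_antimono) simp
  have W: "finite W" unfolding W_def using finite_V level_sub by blast
  fix s1 assume s1: "s1 = effect begin_interval s"
  show "runs (Seq (While more_edges count_edge) end_interval) s1
    ((m * (1 + bcost more_edges + max_cost count_edge) + (1 + bcost more_edges)) + max_cost end_interval)
    (\<lambda>s'. frame s' \<and> var s' v_j = var s v_j \<and> intervals_written (rs @ [r]) s')"
  proof (rule runs_Seq)
    show "runs (While more_edges count_edge) s1
      (m * (1 + bcost more_edges + max_cost count_edge) + (1 + bcost more_edges)) (?I m)"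
    proof (rule runs_For)
      fix k and s' :: state assume "k < m" "?I k s'"
      then show "runs count_edge s' (max_cost count_edge) (?I (Suc k))"
        using counted_Suc W by (intro runs_loop_free) (auto simp: count_edge_def see_def)
    next
      show "?I 0 s1"
        using assms unfolding s1 intervals_written_def
        by (auto simp: counted_def begin_interval_def frame_def selected_0 ends_def W_def r'_def)
    qed (auto simp: counted_def frame_def)
  next
    fix s2 assume I: "?I m s2"
    have "ends (selected r m) = V (level r)"
      unfolding level_selected V_def ends_def by (auto simp: image_iff Bex_def)
    then have U: "W \<union> ends (selected r m) = V (level r)"
      using V_mono[OF sub] by (auto simp: W_def)
    \<comment> \<open>The levels are nested, so the truncated differences computed by
      \<open>end_interval\<close> are the cardinalities of the set differences.\<close>
    have cards: "card (V (level r) - W) = card (V (level r)) - card W"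
      "card (level r - level r') = card (level r) - card (level r')"
      using W sub finite_sub[OF level_sub] V_mono[OF sub]
      by (simp_all add: card_Diff_subset W_def)
    have "frame (effect end_interval s2) \<and> var (effect end_interval s2) v_j = var s v_j \<and>
      intervals_written (rs @ [r]) (effect end_interval s2)"
      using I assms(3) cards
      unfolding intervals_written_def quads_snoc[OF r'_def[symmetric]] r'_def[symmetric] counted_def U
      by (auto simp: end_interval_def frame_def segment_upd segment_Suc W_def card_level numeral_eq_Suc)
    then show "runs end_interval s2 (max_cost end_interval)
      (\<lambda>s'. frame s' \<and> var s' v_j = var s v_j \<and> intervals_written (rs @ [r]) s')"
      by (intro runs_loop_free) (auto simp: end_interval_def)
  qed
qed

lemma onion_levels: "H \<noteq> {} \<Longrightarrow> onion_decomposition H (map level (R # thresholds R))"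
  using load_bound by (intro onion_decomposition_levels) (auto simp: R_def)

lemma graph_list_code_levels:
  assumes "H \<noteq> {}"
  shows "graph_list_code (map level (R # thresholds R))
    (Suc (length (thresholds R)) # 0 # concat (map code (thresholds R)))"
proof -
  have "level R = {}"
    using onion_levels[OF assms] by (simp add: onion_decomposition_def)
  then have "graph_code (level R) [0]" by (auto simp: graph_code_def)
  moreover have "list_all2 graph_code (map level rs) (map code rs)" for rs
    by (simp add: list_all2_conv_all_nth graph_code_level)
  ultimately have "list_all2 graph_code (map level (R # thresholds R)) ([0] # map code (thresholds R))"
    by simp
  then show ?thesis unfolding graph_list_code_def by force
qed

lemma phi_code_levels:
  assumes "H \<noteq> {}" "2 \<le> n"
  shows "phi_code n H (length (thresholds R) # concat (map (\<lambda>(b, d, a, e). [b, d, a, e]) (quads (thresholds R))))"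
proof -
  define rs where "rs = R # thresholds R"
  interpret onion H "map level rs"
    unfolding rs_def by unfold_locales (rule onion_levels[OF assms(1)])
  have len: "length rs = Suc (length (thresholds R))" by (simp add: rs_def)
  have "map (\<lambda>t. (card (map level rs ! t), card H, verts_at t, edges_at t))
      [0..<length (map level rs) - 1] = quads (thresholds R)"
    unfolding quads_def quad_def verts_at_def edges_at_def rs_def[symmetric]
    by (auto simp: card_H len)
  with phi_representation_onion[OF assms(2,1)]
  have "phi_representation n H (quads (thresholds R))" by metis
  moreover have "length (quads (thresholds R)) = length (thresholds R)" by (simp add: quads_def)
  ultimately show ?thesis unfolding phi_code_def by metis
qed

end

definition scan_time :: "nat \<Rightarrow> nat \<Rightarrow> nat" where
  "scan_time T k = ((8 * k ^ 3 + 1) * k + 2) * (1 + bcost more_thresholds +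
     (max_cost (Assign v_r (Minus (Var v_R) (Var v_j))) +
       ((1 + bcost at_threshold + T) + max_cost (inc v_j)))) + (1 + bcost more_thresholds)"

definition full_time :: "com \<Rightarrow> (nat \<Rightarrow> nat) \<Rightarrow> nat \<Rightarrow> nat" where
  "full_time init T k = balance_time k + (max_cost init + (scan_time (T k) k +
     max_cost (Store a_out (Const 0) (Var v_items))))"

context edge_list
begin

text \<open>The loads are known only as part of the state reached by balancing. Hence
  \<open>E\<close> takes them as an argument, and the hypotheses range over all balanced
  distributions for the given edge list.\<close>

lemma runs_full_prog:
  assumes "loop_free init" and T: "1 \<le> T m"
    and E_var: "\<And>X l rs s x v. balanced_edge_list es X l \<Longrightarrow> x \<in> {v_j, v_r} \<Longrightarrow> E l rs s \<Longrightarrow> E l rs (s\<lparr>var := (var s)(x := v)\<rparr>)"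
    and init: "\<And>X s. balanced_edge_list es X (arr s a_load) \<Longrightarrow> arr s a_seen = (\<lambda>_. 0) \<Longrightarrow>
      balanced_edge_list.frame es (arr s a_load) s \<Longrightarrow>
      balanced_edge_list.frame es (arr s a_load) (effect init s) \<and> var (effect init s) v_j = 0 \<and>
      E (arr s a_load) [] (effect init s)"
    and emit: "\<And>X l rs r s. balanced_edge_list es X l \<Longrightarrow>
      balanced_edge_list.frame es l s \<Longrightarrow> var s v_r = r \<Longrightarrow> E l rs s \<Longrightarrow> \<forall>x\<in>set ((N * m + 2) # rs). r < x \<Longrightarrow>
      runs emit s (T m) (\<lambda>s'. balanced_edge_list.frame es l s' \<and> var s' v_j = var s v_j \<and> E l (rs @ [r]) s')"
    and final: "\<And>X l s. balanced_edge_list es X l \<Longrightarrow>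
      E l (balanced_tokens.thresholds H l (N * m + 2)) s \<Longrightarrow>
      Q (effect (Store a_out (Const 0) (Var v_items)) s)"
  shows "runs (full_prog init emit) (init_state input) (full_time init T m) Q"
  unfolding full_prog_def full_time_def
proof (rule runs_Seq[OF runs_balance_prog])
  fix s1 assume s1: "prepared s1"
  define l where "l = arr s1 a_load"
  obtain X where X: "balanced_tokens H N X l"
    using s1 by (auto simp: prepared_def l_def)
  interpret B: balanced_edge_list es X l
    using X s1 by (intro balanced_edge_list.intro balanced_edge_list_axioms.intro edge_list_axioms)
      (auto simp: prepared_def l_def)
  have B: "balanced_edge_list es X l" by unfold_locales
  have s1': "B.frame s1" "arr s1 a_seen = (\<lambda>_. 0)"
    using s1 unfolding prepared_def B.frame_def B.present_def B.R_def l_def[symmetric] by auto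
  show "runs (Seq init (Seq (While more_thresholds (scan_body emit)) (Store a_out (Const 0) (Var v_items)))) s1
    (max_cost init + (scan_time (T m) m + max_cost (Store a_out (Const 0) (Var v_items)))) Q"
  proof (rule runs_Seq[OF runs_effect[OF assms(1)]], rule runs_Seq)
    fix s2 assume s2: "s2 = effect init s1"
    have "B.frame s2 \<and> var s2 v_j = 0 \<and> E l [] s2"
      unfolding s2 l_def using B s1' by (intro init[of X]) (auto simp: l_def)
    then show "runs (While more_thresholds (scan_body emit)) s2 (scan_time (T m) m) (E l (B.thresholds B.R))"
      unfolding scan_time_def N_def[symmetric] B.R_def[symmetric]
      by (intro B.runs_scan E_var[OF B] emit[OF B, folded B.R_def] T) auto
  next
    fix s3 assume "E l (B.thresholds B.R) s3"
    then have "Q (effect (Store a_out (Const 0) (Var v_items)) s3)"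
      unfolding B.R_def by (rule final[OF B])
    then show "runs (Store a_out (Const 0) (Var v_items)) s3 (max_cost (Store a_out (Const 0) (Var v_items))) Q"
      by (intro runs_loop_free) auto
  qed
qed

text \<open>The number of items is known only after the scan, so cell 0 is written last.\<close>

lemma output_final:
  assumes "0 < var s v_out_len"
  shows "output_of (effect (Store a_out (Const 0) (Var v_items)) s) =
    var s v_items # segment (arr s a_out) 1 (var s v_out_len)"
  using segment_split[of 0 0 "var s v_out_len" "(arr s a_out)(0 := var s v_items)"] assms
  by (simp add: output_of_def segment_def segment_upd)

lemma runs_onion:
  assumes "H \<noteq> {}"
  shows "runs (full_prog begin_onion emit_graph) (init_state input)
    (full_time begin_onion emit_graph_time m)
    (\<lambda>s. \<exists>Js. onion_decomposition H Js \<and> graph_list_code Js (output_of s))"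
proof (rule runs_full_prog[where E = "\<lambda>l. balanced_edge_list.graphs_written es l"])
  show "loop_free begin_onion" by (simp add: begin_onion_def)
  show "1 \<le> emit_graph_time m" by (simp add: emit_graph_time_def)
next
  fix X l rs x v and s :: state
  assume B: "balanced_edge_list es X l" and x: "x \<in> {v_j, v_r}"
    and w: "balanced_edge_list.graphs_written es l rs s"
  interpret B: balanced_edge_list es X l by (rule B)
  show "B.graphs_written rs (s\<lparr>var := (var s)(x := v)\<rparr>)"
    using x w by (auto simp: B.graphs_written_def)
next
  fix X and s :: state
  assume B: "balanced_edge_list es X (arr s a_load)" and f: "balanced_edge_list.frame es (arr s a_load) s"
  interpret B: balanced_edge_list es X "arr s a_load" by (rule B)
  show "B.frame (effect begin_onion s) \<and> var (effect begin_onion s) v_j = 0 \<and>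
      B.graphs_written [] (effect begin_onion s)"
    using f by (auto simp: B.graphs_written_def B.frame_def begin_onion_def segment_def upt_rec)
next
  fix X l rs r and s :: state
  assume B: "balanced_edge_list es X l" and "balanced_edge_list.frame es l s" "var s v_r = r"
    "balanced_edge_list.graphs_written es l rs s"
  interpret B: balanced_edge_list es X l by (rule B)
  show "runs emit_graph s (emit_graph_time m)
    (\<lambda>s'. B.frame s' \<and> var s' v_j = var s v_j \<and> B.graphs_written (rs @ [r]) s')"
    by (rule B.runs_emit_graph) fact+
next
  fix X l and s :: state
  assume B: "balanced_edge_list es X l"
    and w: "balanced_edge_list.graphs_written es l (balanced_tokens.thresholds H l (N * m + 2)) s"
  interpret B: balanced_edge_list es X l by (rule B)
  have "output_of (effect (Store a_out (Const 0) (Var v_items)) s) =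
    Suc (length (B.thresholds B.R)) # 0 # concat (map B.code (B.thresholds B.R))"
    using w by (subst output_final) (auto simp: B.graphs_written_def B.R_def)
  then show "\<exists>Js. onion_decomposition H Js \<and>
      graph_list_code Js (output_of (effect (Store a_out (Const 0) (Var v_items)) s))"
    using B.onion_levels[OF assms] B.graph_list_code_levels[OF assms] by metis
qed

lemma runs_phi:
  assumes "H \<noteq> {}" "2 \<le> n"
  shows "runs (full_prog begin_phi emit_interval) (init_state input)
    (full_time begin_phi emit_interval_time m) (\<lambda>s. phi_code n H (output_of s))"
proof (rule runs_full_prog[where E = "\<lambda>l. balanced_edge_list.intervals_written es l"])
  show "loop_free begin_phi" by (simp add: begin_phi_def)
  show "1 \<le> emit_interval_time m" by (simp add: emit_interval_time_def)
next
  fix X l rs x v and s :: state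
  assume B: "balanced_edge_list es X l" and x: "x \<in> {v_j, v_r}"
    and w: "balanced_edge_list.intervals_written es l rs s"
  interpret B: balanced_edge_list es X l by (rule B)
  show "B.intervals_written rs (s\<lparr>var := (var s)(x := v)\<rparr>)"
    using x w by (auto simp: B.intervals_written_def)
next
  fix X and s :: state
  assume B: "balanced_edge_list es X (arr s a_load)" and f: "balanced_edge_list.frame es (arr s a_load) s"
    and seen: "arr s a_seen = (\<lambda>_. 0)"
  interpret B: balanced_edge_list es X "arr s a_load" by (rule B)
  have "B.level B.R = {}"
    using B.onion_levels[OF assms(1)] by (simp add: onion_decomposition_def)
  then show "B.frame (effect begin_phi s) \<and> var (effect begin_phi s) v_j = 0 \<and>
      B.intervals_written [] (effect begin_phi s)"
    using f seen by (auto simp: B.intervals_written_def B.frame_def begin_phi_def segment_def B.quads_def)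
next
  fix X l rs r and s :: state
  assume B: "balanced_edge_list es X l" and f: "balanced_edge_list.frame es l s" "var s v_r = r"
    "balanced_edge_list.intervals_written es l rs s" "\<forall>x\<in>set ((N * m + 2) # rs). r < x"
  interpret B: balanced_edge_list es X l by (rule B)
  show "runs emit_interval s (emit_interval_time m)
    (\<lambda>s'. B.frame s' \<and> var s' v_j = var s v_j \<and> B.intervals_written (rs @ [r]) s')"
    using f by (intro B.runs_emit_interval) (auto simp: B.R_def)
next
  fix X l and s :: state
  assume B: "balanced_edge_list es X l"
    and w: "balanced_edge_list.intervals_written es l (balanced_tokens.thresholds H l (N * m + 2)) s"
  interpret B: balanced_edge_list es X l by (rule B)
  have "output_of (effect (Store a_out (Const 0) (Var v_items)) s) =
    length (B.thresholds B.R) # concat (map (\<lambda>(b, d, a, e). [b, d, a, e]) (B.quads (B.thresholds B.R)))"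
    using w by (subst output_final) (auto simp: B.intervals_written_def B.R_def)
  then show "phi_code n H (output_of (effect (Store a_out (Const 0) (Var v_items)) s))"
    using B.phi_code_levels[OF assms] by metis
qed

end

section \<open>Polynomial running time and assembly of the results\<close>

lemma poly_bounded_full_time: "poly_bounded T \<Longrightarrow> poly_bounded (full_time init T)"
  unfolding full_time_def scan_time_def
  by (intro poly_bounded_intros poly_bounded_balance_time)

lemma poly_bounded_emit_graph_time: "poly_bounded emit_graph_time"
  unfolding emit_graph_time_def by (intro poly_bounded_intros)

lemma poly_bounded_emit_interval_time: "poly_bounded emit_interval_time"
  unfolding emit_interval_time_def by (intro poly_bounded_intros)

lemma card_edge_complete: "H \<subseteq> complete_graph n \<Longrightarrow> e \<in> H \<Longrightarrow> card e = 2"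
  by (auto simp: complete_graph_def nsets_def)

lemma simple_graph_complete: "H \<subseteq> complete_graph n \<Longrightarrow> simple_graph H"
  by (intro simple_graph.intro card_edge_complete)
    (auto simp: complete_graph_def intro: finite_subset finite_imp_finite_nsets)

lemma graph_code_edge_list:
  assumes "graph_code H ws" "H \<subseteq> complete_graph n"
  obtains es where "edge_list es" "edge_list.H es = H" "edge_list.input es = ws" "edge_list.m es = card H"
proof -
  obtain es where es: "distinct (map (\<lambda>(u, v). {u, v}) es)" "set (map (\<lambda>(u, v). {u, v}) es) = H"
    "ws = length es # concat (map (\<lambda>(u, v). [u, v]) es)"
    using assms(1) by (auto simp: graph_code_def)
  \<comment> \<open>A pair with equal entries would code an edge with one element.\<close>
  have "u \<noteq> v" if "(u, v) \<in> set es" for u v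
  proof
    assume "u = v"
    then have "{u} \<in> H" using that es(2) by force
    then show False using card_edge_complete[OF assms(2)] by fastforce
  qed
  then interpret edge_list es using es by unfold_locales
  show thesis
    using that[of es] edge_list_axioms es H_def input_def card_H by metis
qed

text \<open>Existence of the decomposition is obtained from a run of the program, for which some
  input word is required.\<close>

lemma graph_code_exists:
  assumes "simple_graph H"
  shows "\<exists>ws. graph_code H ws"
proof -
  interpret simple_graph H by (rule assms)
  obtain xs where xs: "set xs = H" "distinct xs" using finite_distinct_list[OF finite_H] by blast
  have "\<exists>p. e = {fst p, snd p}" if "e \<in> H" for e :: "nat set"
    using card_edge[OF that] by (auto simp: card_2_iff)
  then obtain f where f: "\<And>e. e \<in> H \<Longrightarrow> e = {fst (f e), snd (f e)}" by metis
  have "map (\<lambda>(u, v). {u, v}) (map f xs) = xs"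
    using f xs by (auto simp: case_prod_beta intro!: map_idI)
  then show ?thesis
    unfolding graph_code_def using xs by metis
qed

lemma onion_computable:
  "poly_time_computable card
    (\<lambda>H ws. H \<noteq> {} \<and> (\<exists>n\<ge>2. H \<subseteq> complete_graph n) \<and> graph_code H ws)
    (\<lambda>H out. \<exists>Js. onion_decomposition H Js \<and> graph_list_code Js out)"
proof -
  obtain p where p: "\<And>k. full_time begin_onion emit_graph_time k \<le> poly p k"
    using poly_bounded_full_time[OF poly_bounded_emit_graph_time] unfolding poly_bounded_def by blast
  have "\<exists>t s. exec (full_prog begin_onion emit_graph) (init_state ws) t s \<and> t \<le> poly p (card H) \<and>
      (\<exists>Js. onion_decomposition H Js \<and> graph_list_code Js (output_of s))"
    if H: "H \<noteq> {}" "H \<subseteq> complete_graph n" "graph_code H ws" for H ws n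
  proof -
    obtain es where es: "edge_list es" "edge_list.H es = H" "edge_list.input es = ws" "edge_list.m es = card H"
      using graph_code_edge_list[OF H(3,2)] by blast
    from edge_list.runs_onion[OF es(1)] show ?thesis
      unfolding es(2-4) runs_def using H(1) p[of "card H"] by (meson le_trans)
  qed
  then show ?thesis unfolding poly_time_computable_def by blast
qed

text \<open>The input word codes only \<open>H\<close>. The breakpoints and exponents do not involve
  \<open>n\<close>, so the same output is correct for every admissible \<open>n\<close>.\<close>

lemma phi_computable:
  "poly_time_computable (\<lambda>(n, H). card H)
    (\<lambda>(n, H) ws. H \<noteq> {} \<and> 2 \<le> n \<and> H \<subseteq> complete_graph n \<and> graph_code H ws)
    (\<lambda>(n, H) out. phi_code n H out)"
proof -
  obtain p where p: "\<And>k. full_time begin_phi emit_interval_time k \<le> poly p k"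
    using poly_bounded_full_time[OF poly_bounded_emit_interval_time] unfolding poly_bounded_def by blast
  have "\<exists>t s. exec (full_prog begin_phi emit_interval) (init_state ws) t s \<and> t \<le> poly p (card H) \<and>
      phi_code n H (output_of s)"
    if H: "H \<noteq> {}" "2 \<le> n" "H \<subseteq> complete_graph n" "graph_code H ws" for H ws n
  proof -
    obtain es where es: "edge_list es" "edge_list.H es = H" "edge_list.input es = ws" "edge_list.m es = card H"
      using graph_code_edge_list[OF H(4,3)] by blast
    from edge_list.runs_phi[OF es(1) _ H(2)] show ?thesis
      unfolding es(2-4) runs_def using H(1) p[of "card H"] by (meson le_trans)
  qed
  then show ?thesis
    unfolding poly_time_computable_def
    by (intro exI[of _ "full_prog begin_phi emit_interval"] exI[of _ p]) auto
qed

lemma onion_decomposition_exists: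
  assumes "H \<noteq> {}" "2 \<le> n" "H \<subseteq> complete_graph n"
  shows "\<exists>Js. onion_decomposition H Js"
  using onion_computable assms graph_code_exists[OF simple_graph_complete[OF assms(3)]]
  unfolding poly_time_computable_def by blast

theorem theorem3p6:
  shows "(\<forall>n H. 2 \<le> n \<and> H \<subseteq> complete_graph n \<and> H \<noteq> {} \<longrightarrow>
      (\<exists>!Js. onion_decomposition H Js) \<and>
      (\<forall>Js. onion_decomposition H Js \<longrightarrow>
        (\<forall>t. t + 1 < length Js \<longrightarrow> (\<exists>!J. onion_step H (Js ! t) J)) \<and>
        (\<forall>q. 0 \<le> q \<and> q < 1 \<longrightarrow>
          (\<exists>!t. t + 1 < length Js \<and>
            real (card (Js ! t)) / real (card H) \<le> q \<and>
            q < real (card (Js ! (t + 1))) / real (card H)) \<and>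
          (\<forall>t. t + 1 < length Js \<and>
            real (card (Js ! t)) / real (card H) \<le> q \<and>
            q < real (card (Js ! (t + 1))) / real (card H) \<longrightarrow>
              phi n H q = real n powr
                (- (real (card (V (Js ! (t + 1)) - V (Js ! t))) /
                    real (card (Js ! (t + 1) - Js ! t)))) \<and>
              phi n H q = real n powr
                (- real_of_ereal (1 / rho (Js ! (t + 1)) (Js ! t))) \<and>
              minimax_optimal n H q (Js ! t) (Js ! (t + 1))))))
    \<and> poly_time_computable card
        (\<lambda>H ws. H \<noteq> {} \<and> (\<exists>n\<ge>2. H \<subseteq> complete_graph n) \<and> graph_code H ws)
        (\<lambda>H out. \<exists>Js. onion_decomposition H Js \<and> graph_list_code Js out)
    \<and> poly_time_computable (\<lambda>(n, H). card H)
        (\<lambda>(n, H) ws. H \<noteq> {} \<and> 2 \<le> n \<and> H \<subseteq> complete_graph n \<and> graph_code H ws)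
        (\<lambda>(n, H) out. phi_code n H out)"
proof (intro conjI allI impI onion_computable phi_computable)
  fix n and H :: graph
  assume "2 \<le> n \<and> H \<subseteq> complete_graph n \<and> H \<noteq> {}"
  then have n: "2 \<le> n" and H: "H \<subseteq> complete_graph n" and ne: "H \<noteq> {}" by auto
  interpret simple_graph H by (rule simple_graph_complete[OF H])
  show "\<exists>!Js. onion_decomposition H Js"
    using onion_decomposition_exists[OF ne n H] onion_decomposition_unique by blast
  fix Js assume "onion_decomposition H Js"
  then interpret onion H Js by unfold_locales
  show "\<exists>!J. onion_step H (Js ! t) J" if "t + 1 < length Js" for t
    using step[OF that] onion_step_unique[OF induced_nth[of t]] that by auto
  fix q :: real
  assume "0 \<le> q \<and> q < 1"
  then have q: "0 \<le> q" "q < 1" by auto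
  show "\<exists>!t. t + 1 < length Js \<and> real (card (Js ! t)) / real (card H) \<le> q \<and>
    q < real (card (Js ! (t + 1))) / real (card H)"
    by (rule interval_exists[OF ne q])
  fix t
  assume "t + 1 < length Js \<and> real (card (Js ! t)) / real (card H) \<le> q \<and>
    q < real (card (Js ! (t + 1))) / real (card H)"
  then have t: "t + 1 < length Js" "real (card (Js ! t)) / real (card H) \<le> q"
    "q < real (card (Js ! (t + 1))) / real (card H)" by auto
  note opt = minimax_nth[OF n ne t(1) q(2) t(2,3)]
  show "phi n H q = real n powr
      (- (real (card (V (Js ! (t + 1)) - V (Js ! t))) / real (card (Js ! (t + 1) - Js ! t))))"
    using opt(1) by (simp only: verts_at_def edges_at_def)
  show "phi n H q = real n powr (- real_of_ereal (1 / rho (Js ! (t + 1)) (Js ! t)))"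
    using opt(1) by (simp only: inverse_rho_nth[OF t(1)])
  show "minimax_optimal n H q (Js ! t) (Js ! (t + 1))" by (rule opt(2))
qed

end
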